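(* There exists a separable Banach space $\tilde{\mathcal{B}}$ with an unconditional Schauder basis such that a Banach space $X$ has an unconditional Schauder frame if and only if $X$ is isomorphic to a complemented subspace of $\tilde{\mathcal{B}}$.
   Context: Banach spaces are over $\mathbb{K}\in\{\mathbb{R},\mathbb{C}\}$ (a fixed scalar field); $X^*$ denotes the topological dual of $X$. A Schauder basis of a Banach space $X$ is a sequence $(x_n)_{n\ge 1}$ in $X$ such that for every $x\in X$ there is a unique sequence of scalars $(\alpha_n)_{n\ge1}$ with $x=\sum_{n=1}^{\infty}\alpha_n x_n$; it is unconditional if all these expansions converge unconditionally. An unconditional Schauder frame of $X$ is a sequence $\{(x_n,f_n)\}_{n\ge 1}\subset X\times X^*$ such that for every $x\in X$ the series $\sum_n f_n(x)x_n$ converges unconditionally to $x$. Isomorphic means linearly homeomorphic. A complemented subspace is the range of a bounded linear projection. *)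

theory Defs
  imports Complex_Main "HOL-Library.Countable_Set" "HOL-Library.Function_Algebras"
begin

text \<open>
  A normed space over the scalar field \<open>'k\<close> is a linear subspace \<open>vecs V\<close> of an ambient vector
  space on the type \<open>'a\<close>, with a norm that is only relevant on \<open>vecs V\<close>. Spaces are values, not
  types, so that they can be quantified over inside a formula. With \<open>vecs V = UNIV\<close> this covers
  every vector space on a type \<open>'a\<close>.
\<close>

record ('k, 'a) nspace =
  scal :: "'k \<Rightarrow> 'a \<Rightarrow> 'a"
  vecs :: "'a set"
  nrm :: "'a \<Rightarrow> real"

definition normed_space :: "('k::real_normed_field, 'a::ab_group_add) nspace \<Rightarrow> bool" where
  "normed_space V \<longleftrightarrow>
     vector_space (scal V) \<and> module.subspace (scal V) (vecs V) \<and>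
     (\<forall>x\<in>vecs V. 0 \<le> nrm V x \<and> (nrm V x = 0 \<longleftrightarrow> x = 0)) \<and>
     (\<forall>c. \<forall>x\<in>vecs V. nrm V (scal V c x) = norm c * nrm V x) \<and>
     (\<forall>x\<in>vecs V. \<forall>y\<in>vecs V. nrm V (x + y) \<le> nrm V x + nrm V y)"

definition converges_in :: "('k, 'a::ab_group_add) nspace \<Rightarrow> (nat \<Rightarrow> 'a) \<Rightarrow> 'a \<Rightarrow> bool" where
  "converges_in V s x \<longleftrightarrow> x \<in> vecs V \<and> (\<lambda>n. nrm V (s n - x)) \<longlonglongrightarrow> 0"

definition cauchy_in :: "('k, 'a::ab_group_add) nspace \<Rightarrow> (nat \<Rightarrow> 'a) \<Rightarrow> bool" where
  "cauchy_in V s \<longleftrightarrow> (\<forall>e>0. \<exists>N. \<forall>m\<ge>N. \<forall>n\<ge>N. nrm V (s m - s n) < e)"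

definition banach_space :: "('k::real_normed_field, 'a::ab_group_add) nspace \<Rightarrow> bool" where
  "banach_space V \<longleftrightarrow> normed_space V \<and>
     (\<forall>s. range s \<subseteq> vecs V \<and> cauchy_in V s \<longrightarrow> (\<exists>x. converges_in V s x))"

definition separable_in_norm :: "('k, 'a::ab_group_add) nspace \<Rightarrow> bool" where
  "separable_in_norm V \<longleftrightarrow>
     (\<exists>D. countable D \<and> D \<subseteq> vecs V \<and> (\<forall>x\<in>vecs V. \<forall>e>0. \<exists>d\<in>D. nrm V (x - d) < e))"

definition sums_in :: "('k, 'a::ab_group_add) nspace \<Rightarrow> (nat \<Rightarrow> 'a) \<Rightarrow> 'a \<Rightarrow> bool" where
  "sums_in V a x \<longleftrightarrow> converges_in V (\<lambda>n. \<Sum>i<n. a i) x"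

text \<open>Unconditional convergence: every rearrangement of the series converges to the same sum.\<close>

definition unconditionally_sums_in ::
    "('k, 'a::ab_group_add) nspace \<Rightarrow> (nat \<Rightarrow> 'a) \<Rightarrow> 'a \<Rightarrow> bool" where
  "unconditionally_sums_in V a x \<longleftrightarrow> (\<forall>\<pi>. bij \<pi> \<longrightarrow> sums_in V (a \<circ> \<pi>) x)"

definition schauder_basis :: "('k, 'a::ab_group_add) nspace \<Rightarrow> (nat \<Rightarrow> 'a) \<Rightarrow> bool" where
  "schauder_basis V b \<longleftrightarrow> range b \<subseteq> vecs V \<and>
     (\<forall>x\<in>vecs V. \<exists>!\<alpha>. sums_in V (\<lambda>n. scal V (\<alpha> n) (b n)) x)"

definition unconditional_schauder_basis ::
    "('k, 'a::ab_group_add) nspace \<Rightarrow> (nat \<Rightarrow> 'a) \<Rightarrow> bool" where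
  "unconditional_schauder_basis V b \<longleftrightarrow> schauder_basis V b \<and>
     (\<forall>x\<in>vecs V. \<forall>\<alpha>. sums_in V (\<lambda>n. scal V (\<alpha> n) (b n)) x \<longrightarrow>
        unconditionally_sums_in V (\<lambda>n. scal V (\<alpha> n) (b n)) x)"

text \<open>Only the values of \<open>T\<close> on \<open>vecs V\<close> are constrained.\<close>

definition bounded_linear_map ::
    "('k, 'a::ab_group_add) nspace \<Rightarrow> ('k, 'b::ab_group_add) nspace \<Rightarrow> ('a \<Rightarrow> 'b) \<Rightarrow> bool" where
  "bounded_linear_map V W T \<longleftrightarrow> T ` vecs V \<subseteq> vecs W \<and>
     (\<forall>x\<in>vecs V. \<forall>y\<in>vecs V. T (x + y) = T x + T y) \<and>
     (\<forall>c. \<forall>x\<in>vecs V. T (scal V c x) = scal W c (T x)) \<and>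
     (\<exists>C. \<forall>x\<in>vecs V. nrm W (T x) \<le> C * nrm V x)"

definition scalar_space :: "('k::real_normed_field, 'k) nspace" where
  "scalar_space = \<lparr>scal = (*), vecs = UNIV, nrm = norm\<rparr>"

definition topological_dual ::
    "('k::real_normed_field, 'a::ab_group_add) nspace \<Rightarrow> ('a \<Rightarrow> 'k) set" where
  "topological_dual V = {f. bounded_linear_map V scalar_space f}"

definition unconditional_schauder_frame ::
    "('k::real_normed_field, 'a::ab_group_add) nspace \<Rightarrow> (nat \<Rightarrow> 'a \<times> ('a \<Rightarrow> 'k)) \<Rightarrow> bool" where
  "unconditional_schauder_frame V F \<longleftrightarrow> range F \<subseteq> vecs V \<times> topological_dual V \<and>
     (\<forall>x\<in>vecs V. unconditionally_sums_in V (\<lambda>n. scal V (snd (F n) x) (fst (F n))) x)"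

definition isomorphic ::
    "('k, 'a::ab_group_add) nspace \<Rightarrow> ('k, 'b::ab_group_add) nspace \<Rightarrow> bool" where
  "isomorphic V W \<longleftrightarrow> (\<exists>T U. bounded_linear_map V W T \<and> bounded_linear_map W V U \<and>
     (\<forall>x\<in>vecs V. U (T x) = x) \<and> (\<forall>y\<in>vecs W. T (U y) = y))"

definition complemented_subspace ::
    "('k, 'a::ab_group_add) nspace \<Rightarrow> ('k, 'a) nspace \<Rightarrow> bool" where
  "complemented_subspace V Z \<longleftrightarrow> (\<exists>P. bounded_linear_map V V P \<and>
     (\<forall>x\<in>vecs V. P (P x) = P x) \<and> Z = V\<lparr>vecs := P ` vecs V\<rparr>)"

definition separable_with_unconditional_basis ::
    "('k::real_normed_field, 'b::ab_group_add) nspace \<Rightarrow> bool" where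
  "separable_with_unconditional_basis B \<longleftrightarrow> banach_space B \<and> separable_in_norm B \<and>
     (\<exists>b. unconditional_schauder_basis B b)"

definition characterizes_frames ::
    "'a::ab_group_add itself \<Rightarrow> ('k::real_normed_field, 'b::ab_group_add) nspace \<Rightarrow> bool" where
  "characterizes_frames _ B \<longleftrightarrow> (\<forall>X :: ('k, 'a) nspace. banach_space X \<longrightarrow>
     ((\<exists>F. unconditional_schauder_frame X F) \<longleftrightarrow>
      (\<exists>Z. complemented_subspace B Z \<and> isomorphic X Z)))"

text \<open>
  HOL cannot quantify over types inside an existential, so "there is a space \<open>B\<close> that works for
  Banach spaces \<open>X\<close> on all types" is expressed for a scalar field \<open>'k\<close> in two parts: a suitable
  \<open>B\<close> exists for all \<open>X\<close> carried by \<open>nat \<Rightarrow> 'k\<close> (this type has the cardinality of the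
  continuum, so it carries a copy of every separable Banach space), and every such \<open>B\<close> works
  for all \<open>X\<close> on an arbitrary type \<open>'a\<close>. Since the condition on \<open>B\<close> in the first part does not
  mention \<open>'a\<close>, one and the same \<open>B\<close> serves all types.
\<close>

end

theory Submission
  imports Defs "HOL-Analysis.Analysis"
begin

text \<open>
  The universal space is a weighted sequence space. A set of weights gives the norm
  \<open>\<parallel>a\<parallel> = sup \<phi>. \<Sum>i. \<phi> i * \<bar>a i\<bar>\<close>, and since this norm sees only the moduli of the coordinates, the unit
  vectors form an unconditional basis of the completion of the finitely supported sequences.
  The weights have to be chosen such that every unconditional norm reappears, up to
  equivalence, on some subset of the coordinates.

  Let \<open>(v k, f k)\<close> be an unconditional frame of \<open>X\<close>, and \<open>u k = v k / \<parallel>v k\<parallel>\<close>. The norm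
  \<open>c \<mapsto> sup \<epsilon>. \<parallel>\<Sum>k. \<epsilon> k * c k * u k\<parallel>\<close>, with \<open>\<bar>\<epsilon> k\<bar> \<le> 1\<close>, is a supremum of expressions \<open>\<Sum>k. w k * \<bar>c k\<bar>\<close>
  with \<open>0 \<le> w k \<le> 1\<close>, by the Hahn-Banach theorem (\<open>norming_weight\<close>). Rounding each \<open>w k\<close> down to
  a multiple of \<open>1 / 2 ^ k\<close> loses at most \<open>2 * sup k. \<bar>c k\<bar>\<close>, and afterwards there are only finitely
  many initial segments of each length. So the set \<open>W\<close> of rounded weights determines finite
  sets \<open>level_set W k\<close>, the initial segments of length \<open>k + 1\<close>, and altogether only countably many
  finite sets can occur. They are the coordinates of the universal space. The coordinates
  \<open>level_set W 0, level_set W 1, \<dots>\<close> form the branch of \<open>W\<close>, and every member of \<open>W\<close> is a weight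
  supported on this branch. If the branches of \<open>W\<close> and \<open>W'\<close> meet at level \<open>k\<close>, then \<open>W\<close> and
  \<open>W'\<close> have the same initial segments up to \<open>k\<close>; hence the weights from other branches add nothing
  to the norm on the branch of \<open>X\<close> (\<open>universal_weight_on_branch\<close>).

  The map that puts \<open>\<parallel>v k\<parallel> * f k x\<close> on the \<open>k\<close>-th place of the branch, and the map that sends
  \<open>a\<close> to \<open>\<Sum>k. a k * u k\<close> over the branch, are then bounded (\<open>bounded_linear_embed\<close>,
  \<open>bounded_linear_retract\<close>), and their composition is the identity of \<open>X\<close>. So \<open>X\<close> is isomorphic to
  a complemented subspace. Conversely, a projection carries a basis and its coefficient
  functionals to a frame of its range (\<open>frame_of_complemented\<close>). Both directions need an automatic
  continuity result, a uniform bound for the partial sums of a frame and the continuity of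
  the coefficient functionals; both come from Zabreiko's lemma (\<open>zabreiko\<close>), that is, from the
  Baire category theorem.

  A space \<open>X\<close> with a frame on an arbitrary type is thus isomorphic to a complemented subspace \<open>Z\<close>
  of the universal space. As \<open>Z\<close> consists of sequences and has a frame, every \<open>B\<close> that is
  universal for spaces of sequences contains \<open>Z\<close>, hence \<open>X\<close>, as a complemented subspace.
\<close>

section \<open>Normed spaces as records\<close>

lemma LIMSEQ_squeeze_zero:
  fixes f g :: "nat \<Rightarrow> real"
  assumes "g \<longlonglongrightarrow> 0" "\<And>n. 0 \<le> f n" "\<And>n. f n \<le> g n"
  shows "f \<longlonglongrightarrow> 0"
  by (rule Lim_null_comparison[OF _ assms(1)]) (simp add: assms)

locale normed =
  fixes V :: "('k::real_normed_field, 'a::ab_group_add) nspace"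
  assumes normed_space: "normed_space V"
begin

sublocale vector_space "scal V"
  using normed_space unfolding normed_space_def by blast

lemma subspace_vecs: "subspace (vecs V)"
  using normed_space unfolding normed_space_def by blast

lemma zero_mem [simp, intro]: "0 \<in> vecs V"
  using subspace_vecs subspace_0 by blast

lemma add_mem [simp, intro]: "x \<in> vecs V \<Longrightarrow> y \<in> vecs V \<Longrightarrow> x + y \<in> vecs V"
  using subspace_vecs subspace_add by blast

lemma scal_mem [simp, intro]: "x \<in> vecs V \<Longrightarrow> scal V c x \<in> vecs V"
  using subspace_vecs subspace_scale by blast

lemma minus_mem [simp, intro]: "x \<in> vecs V \<Longrightarrow> - x \<in> vecs V"
  using subspace_vecs subspace_neg by blast

lemma diff_mem [simp, intro]: "x \<in> vecs V \<Longrightarrow> y \<in> vecs V \<Longrightarrow> x - y \<in> vecs V"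
  using subspace_vecs subspace_diff by blast

lemma sum_mem [simp, intro]: "(\<And>i. i \<in> A \<Longrightarrow> f i \<in> vecs V) \<Longrightarrow> sum f A \<in> vecs V"
  using subspace_vecs subspace_sum by blast

lemma nrm_nonneg [simp]: "x \<in> vecs V \<Longrightarrow> 0 \<le> nrm V x"
  using normed_space unfolding normed_space_def by blast

lemma nrm_eq_0: "x \<in> vecs V \<Longrightarrow> nrm V x = 0 \<longleftrightarrow> x = 0"
  using normed_space unfolding normed_space_def by blast

lemma nrm_zero [simp]: "nrm V 0 = 0"
  by (simp add: nrm_eq_0)

lemma nrm_scal [simp]: "x \<in> vecs V \<Longrightarrow> nrm V (scal V c x) = norm c * nrm V x"
  using normed_space unfolding normed_space_def by blast

lemma nrm_add: "x \<in> vecs V \<Longrightarrow> y \<in> vecs V \<Longrightarrow> nrm V (x + y) \<le> nrm V x + nrm V y"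
  using normed_space unfolding normed_space_def by blast

lemma nrm_minus [simp]: "x \<in> vecs V \<Longrightarrow> nrm V (- x) = nrm V x"
  using nrm_scal[of x "-1"] by (simp add: scale_minus_left)

lemma nrm_minus_commute: "x \<in> vecs V \<Longrightarrow> y \<in> vecs V \<Longrightarrow> nrm V (x - y) = nrm V (y - x)"
  using nrm_minus[of "x - y"] by simp

lemma nrm_diff: "x \<in> vecs V \<Longrightarrow> y \<in> vecs V \<Longrightarrow> nrm V (x - y) \<le> nrm V x + nrm V y"
  using nrm_add[of x "- y"] by simp

lemma nrm_le_add_diff: "x \<in> vecs V \<Longrightarrow> y \<in> vecs V \<Longrightarrow> nrm V x \<le> nrm V y + nrm V (x - y)"
  using nrm_add[of y "x - y"] by simp

lemma nrm_triangle:
  "x \<in> vecs V \<Longrightarrow> y \<in> vecs V \<Longrightarrow> z \<in> vecs V \<Longrightarrow>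
     nrm V (x - z) \<le> nrm V (x - y) + nrm V (y - z)"
  using nrm_add[of "x - y" "y - z"] by simp

lemma nrm_sum:
  "(\<And>i. i \<in> A \<Longrightarrow> f i \<in> vecs V) \<Longrightarrow> nrm V (sum f A) \<le> (\<Sum>i\<in>A. nrm V (f i))"
proof (induction A rule: infinite_finite_induct)
  case (insert k A)
  have "nrm V (f k + sum f A) \<le> nrm V (f k) + nrm V (sum f A)"
    using insert by (intro nrm_add) auto
  with insert show ?case by fastforce
qed auto

lemma converges_in_mem: "converges_in V s x \<Longrightarrow> x \<in> vecs V"
  by (simp add: converges_in_def)

lemma converges_inD:
  assumes "converges_in V s x" "e > 0" "range s \<subseteq> vecs V"
  obtains N where "\<And>n. n \<ge> N \<Longrightarrow> nrm V (s n - x) < e"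
proof -
  have "(\<lambda>n. nrm V (s n - x)) \<longlonglongrightarrow> 0" "x \<in> vecs V"
    using assms by (auto simp: converges_in_def)
  then obtain N where "\<forall>n\<ge>N. norm (nrm V (s n - x) - 0) < e"
    using LIMSEQ_D assms(2) by blast
  then show ?thesis using that[of N] by (metis abs_less_iff diff_zero real_norm_def)
qed

lemma converges_inI:
  assumes "x \<in> vecs V" "range s \<subseteq> vecs V"
    and "\<And>e. e > 0 \<Longrightarrow> \<exists>N. \<forall>n\<ge>N. nrm V (s n - x) \<le> e"
  shows "converges_in V s x"
  unfolding converges_in_def
proof (intro conjI LIMSEQ_I)
  fix r :: real assume "r > 0"
  then obtain N where N: "\<forall>n\<ge>N. nrm V (s n - x) \<le> r / 2" using assms(3)[of "r/2"] by auto
  have "nrm V (s n - x) \<ge> 0" for n using assms(1,2) by (intro nrm_nonneg) auto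
  with N \<open>r > 0\<close> show "\<exists>no. \<forall>n\<ge>no. norm (nrm V (s n - x) - 0) < r"
    by (intro exI[of _ N]) fastforce
qed (use assms in auto)

lemma converges_in_const: "x \<in> vecs V \<Longrightarrow> converges_in V (\<lambda>n. x) x"
  by (simp add: converges_in_def)

lemma converges_in_unique:
  assumes "converges_in V s x" "converges_in V s y" "range s \<subseteq> vecs V"
  shows "x = y"
proof -
  have xy: "x \<in> vecs V" "y \<in> vecs V" using assms converges_in_mem by auto
  have "nrm V (x - y) \<le> nrm V (s n - x) + nrm V (s n - y)" for n
    using nrm_triangle[of x "s n" y] nrm_minus_commute[of x "s n"] xy assms(3) by auto
  moreover have "(\<lambda>n. nrm V (s n - x) + nrm V (s n - y)) \<longlonglongrightarrow> 0 + 0"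
    using assms by (intro tendsto_add) (auto simp: converges_in_def)
  ultimately have "nrm V (x - y) \<le> 0"
    by (intro LIMSEQ_le_const[of "\<lambda>n. nrm V (s n - x) + nrm V (s n - y)"]) auto
  then have "nrm V (x - y) = 0" using xy by (intro antisym) auto
  then show ?thesis using nrm_eq_0[of "x - y"] xy by auto
qed

lemma nrm_limit_le:
  assumes "converges_in V s x" "range s \<subseteq> vecs V" and le: "\<And>n. n \<ge> N \<Longrightarrow> nrm V (s n) \<le> c"
  shows "nrm V x \<le> c"
proof -
  have x: "x \<in> vecs V" using assms converges_in_mem by auto
  have "(\<lambda>n. c + nrm V (s n - x)) \<longlonglongrightarrow> c + 0"
    using assms by (intro tendsto_add) (auto simp: converges_in_def)
  moreover have "nrm V x \<le> c + nrm V (s n - x)" if "n \<ge> N" for n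
    using nrm_le_add_diff[of x "s n"] nrm_minus_commute[of x "s n"] le[OF that] x assms(2)
    by (smt (verit, best) UNIV_I image_subset_iff)
  ultimately show ?thesis
    by (intro LIMSEQ_le_const[of "\<lambda>n. c + nrm V (s n - x)"]) auto
qed

lemma converges_in_add:
  assumes "converges_in V s x" "converges_in V t y" "range s \<subseteq> vecs V" "range t \<subseteq> vecs V"
  shows "converges_in V (\<lambda>n. s n + t n) (x + y)"
proof -
  have xy: "x \<in> vecs V" "y \<in> vecs V" using assms converges_in_mem by auto
  have *: "nrm V (s n + t n - (x + y)) \<le> nrm V (s n - x) + nrm V (t n - y)" for n
  proof -
    have eq: "s n + t n - (x + y) = (s n - x) + (t n - y)" by simp
    have "s n \<in> vecs V" "t n \<in> vecs V" using assms by auto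
    then show ?thesis unfolding eq using xy by (intro nrm_add) auto
  qed
  have "(\<lambda>n. nrm V (s n - x) + nrm V (t n - y)) \<longlonglongrightarrow> 0 + 0"
    using assms by (intro tendsto_add) (auto simp: converges_in_def)
  moreover have ge: "0 \<le> nrm V (s n + t n - (x + y))" for n
    using xy assms(3,4) by (intro nrm_nonneg diff_mem add_mem) auto
  ultimately have "(\<lambda>n. nrm V (s n + t n - (x + y))) \<longlonglongrightarrow> 0"
    by (intro LIMSEQ_squeeze_zero[OF _ ge *]) simp
  then show ?thesis using xy by (simp add: converges_in_def)
qed

lemma converges_in_cauchy:
  assumes "converges_in V s x" "range s \<subseteq> vecs V"
  shows "cauchy_in V s"
  unfolding cauchy_in_def
proof (intro allI impI)
  fix e :: real assume "e > 0"
  then obtain N where N: "\<And>n. n \<ge> N \<Longrightarrow> nrm V (s n - x) < e / 2"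
    using converges_inD[OF assms(1) _ assms(2), of "e/2"] by auto
  have "nrm V (s m - s n) < e" if "m \<ge> N" "n \<ge> N" for m n
    using nrm_triangle[of "s m" x "s n"] nrm_minus_commute[of x "s n"] N[OF that(1)] N[OF that(2)]
      assms(2) converges_in_mem[OF assms(1)] by (auto simp: image_subset_iff)
  then show "\<exists>N. \<forall>m\<ge>N. \<forall>n\<ge>N. nrm V (s m - s n) < e" by blast
qed

lemma sums_in_mem: "sums_in V a x \<Longrightarrow> x \<in> vecs V"
  by (simp add: sums_in_def converges_in_def)

lemma sums_in_unique:
  "sums_in V a x \<Longrightarrow> sums_in V a y \<Longrightarrow> range a \<subseteq> vecs V \<Longrightarrow> x = y"
  unfolding sums_in_def
  by (rule converges_in_unique[of "\<lambda>n. \<Sum>i<n. a i"]) (auto intro!: sum_mem)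

lemma sums_in_add:
  assumes "sums_in V a x" "sums_in V b y" "range a \<subseteq> vecs V" "range b \<subseteq> vecs V"
  shows "sums_in V (\<lambda>n. a n + b n) (x + y)"
proof -
  have "(\<Sum>i<n. a i) \<in> vecs V" "(\<Sum>i<n. b i) \<in> vecs V" for n :: nat
    using assms(3,4) by (auto intro!: sum_mem)
  then have "converges_in V (\<lambda>n. (\<Sum>i<n. a i) + (\<Sum>i<n. b i)) (x + y)"
    using assms(1,2) unfolding sums_in_def by (intro converges_in_add image_subsetI)
  then show ?thesis by (simp add: sums_in_def sum.distrib)
qed

lemma scal_of_real_convex:
  assumes "x \<in> vecs V" "y \<in> vecs V" "nrm V x \<le> c" "nrm V y \<le> c" "0 \<le> t" "t \<le> 1"
  shows "nrm V (scal V (of_real t) x + scal V (of_real (1 - t)) y) \<le> c"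
proof -
  have "nrm V (scal V (of_real t) x + scal V (of_real (1 - t)) y) \<le> t * nrm V x + (1 - t) * nrm V y"
    using nrm_add[of "scal V (of_real t) x" "scal V (of_real (1 - t)) y"] assms
    by (simp del: of_real_diff add: norm_of_real)
  also have "\<dots> \<le> t * c + (1 - t) * c"
    using assms by (intro add_mono mult_left_mono) auto
  finally show ?thesis by (simp add: algebra_simps)
qed

end

locale banach_nspace = normed +
  assumes banach: "banach_space V"
begin

lemma cauchy_converges:
  "range s \<subseteq> vecs V \<Longrightarrow> cauchy_in V s \<Longrightarrow> \<exists>x. converges_in V s x"
  using banach unfolding banach_space_def by blast

lemma series_converges:
  assumes a: "range a \<subseteq> vecs V"
    and tails: "\<And>e. e > 0 \<Longrightarrow> \<exists>N. \<forall>m\<ge>N. \<forall>n\<ge>m. nrm V (\<Sum>i\<in>{m..<n}. a i) \<le> e"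
  shows "\<exists>x. sums_in V a x"
  unfolding sums_in_def
proof (rule cauchy_converges)
  have mem: "(\<Sum>i\<in>A. a i) \<in> vecs V" for A using a by (intro sum_mem) auto
  show "range (\<lambda>n. \<Sum>i<n. a i) \<subseteq> vecs V" using mem by auto
  show "cauchy_in V (\<lambda>n. \<Sum>i<n. a i)"
    unfolding cauchy_in_def
  proof (intro allI impI)
    fix e :: real assume "e > 0"
    then obtain N where N: "\<forall>m\<ge>N. \<forall>n\<ge>m. nrm V (\<Sum>i\<in>{m..<n}. a i) \<le> e / 2"
      using tails[of "e/2"] by auto
    have split: "(\<Sum>i<n. a i) - (\<Sum>i<m. a i) = (\<Sum>i\<in>{m..<n}. a i)" if "m \<le> n" for m n
      using sum_diff_nat_ivl[of 0 m n a] that by (simp add: lessThan_atLeast0)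
    have "nrm V ((\<Sum>i<m. a i) - (\<Sum>i<n. a i)) < e" if "m \<ge> N" "n \<ge> N" for m n
    proof (cases "m \<le> n")
      case True
      then have "nrm V ((\<Sum>i<n. a i) - (\<Sum>i<m. a i)) \<le> e / 2"
        using N that split[OF True] by simp
      then show ?thesis
        using \<open>e > 0\<close> nrm_minus_commute[OF mem mem, of "{..<m}" "{..<n}"] by simp
    next
      case False
      then have "nrm V ((\<Sum>i<m. a i) - (\<Sum>i<n. a i)) \<le> e / 2"
        using N that split[of n m] by simp
      then show ?thesis using \<open>e > 0\<close> by simp
    qed
    then show "\<exists>N. \<forall>m\<ge>N. \<forall>n\<ge>N. nrm V ((\<Sum>i<m. a i) - (\<Sum>i<n. a i)) < e" by blast
  qed
qed

end

lemma banach_nspaceI: "banach_space V \<Longrightarrow> banach_nspace V"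
  by (simp add: banach_nspace_def normed_def banach_nspace_axioms_def banach_space_def)

section \<open>Bounded linear maps\<close>

lemma bounded_linear_mapD:
  assumes "bounded_linear_map V W T"
  shows "\<And>x. x \<in> vecs V \<Longrightarrow> T x \<in> vecs W"
    and "\<And>x y. x \<in> vecs V \<Longrightarrow> y \<in> vecs V \<Longrightarrow> T (x + y) = T x + T y"
    and "\<And>c x. x \<in> vecs V \<Longrightarrow> T (scal V c x) = scal W c (T x)"
  using assms unfolding bounded_linear_map_def by auto

lemma bounded_linear_map_bound:
  assumes "bounded_linear_map V W T" "normed_space V"
  obtains C where "C \<ge> 0" "\<And>x. x \<in> vecs V \<Longrightarrow> nrm W (T x) \<le> C * nrm V x"
proof -
  interpret V: normed V by unfold_locales fact
  obtain C where C: "\<forall>x\<in>vecs V. nrm W (T x) \<le> C * nrm V x"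
    using assms unfolding bounded_linear_map_def by auto
  have "nrm W (T x) \<le> max C 0 * nrm V x" if "x \<in> vecs V" for x
    using C that mult_right_mono[of C "max C 0" "nrm V x"] by fastforce
  then show ?thesis using that[of "max C 0"] by auto
qed

lemma bounded_linear_map_zero:
  assumes "bounded_linear_map V W T" "normed_space V"
  shows "T 0 = 0"
proof -
  interpret V: normed V by unfold_locales fact
  have "T (0 + 0) = T 0 + T 0" using bounded_linear_mapD(2)[OF assms(1)] by blast
  then show ?thesis by simp
qed

lemma bounded_linear_map_diff:
  assumes "bounded_linear_map V W T" "normed_space V" "x \<in> vecs V" "y \<in> vecs V"
  shows "T (x - y) = T x - T y"
proof -
  interpret V: normed V by unfold_locales fact
  have "T ((x - y) + y) = T (x - y) + T y"
    by (rule bounded_linear_mapD(2)[OF assms(1)]) (use assms in auto)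
  then show ?thesis by (simp add: algebra_simps)
qed

lemma bounded_linear_map_sum:
  assumes "bounded_linear_map V W T" "normed_space V" "\<And>i. i \<in> A \<Longrightarrow> f i \<in> vecs V"
  shows "T (\<Sum>i\<in>A. f i) = (\<Sum>i\<in>A. T (f i))"
proof -
  interpret V: normed V by unfold_locales fact
  show ?thesis using assms(3)
  proof (induction A rule: infinite_finite_induct)
    case (insert k A)
    have "T (f k + sum f A) = T (f k) + T (sum f A)"
      by (rule bounded_linear_mapD(2)[OF assms(1)]) (use insert in auto)
    with insert show ?case by simp
  qed (use bounded_linear_map_zero[OF assms(1,2)] in auto)
qed

lemma bounded_linear_map_comp:
  assumes T: "bounded_linear_map V W T" and S: "bounded_linear_map W Z S"
    and "normed_space V" "normed_space W"
  shows "bounded_linear_map V Z (\<lambda>x. S (T x))"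
proof -
  interpret V: normed V by unfold_locales fact
  obtain C where C: "C \<ge> 0" "\<And>x. x \<in> vecs V \<Longrightarrow> nrm W (T x) \<le> C * nrm V x"
    using bounded_linear_map_bound[OF T assms(3)] by blast
  obtain D where D: "D \<ge> 0" "\<And>x. x \<in> vecs W \<Longrightarrow> nrm Z (S x) \<le> D * nrm W x"
    using bounded_linear_map_bound[OF S assms(4)] by blast
  have "nrm Z (S (T x)) \<le> (D * C) * nrm V x" if "x \<in> vecs V" for x
    using D(2)[of "T x"] C(2)[of x] D(1) that bounded_linear_mapD(1)[OF T]
      mult_left_mono[of "nrm W (T x)" "C * nrm V x" D] by (fastforce simp: mult.assoc)
  then show ?thesis
    using bounded_linear_mapD[OF T] bounded_linear_mapD[OF S]
    unfolding bounded_linear_map_def by (auto simp: image_subset_iff)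
qed

lemma bounded_linear_map_converges:
  assumes T: "bounded_linear_map V W T" and "normed_space V" "normed_space W"
    and s: "converges_in V s x" "range s \<subseteq> vecs V"
  shows "converges_in W (\<lambda>n. T (s n)) (T x)"
proof -
  interpret V: normed V by unfold_locales fact
  interpret W: normed W by unfold_locales fact
  have x: "x \<in> vecs V" using s by (simp add: converges_in_def)
  obtain C where C: "C \<ge> 0" "\<And>x. x \<in> vecs V \<Longrightarrow> nrm W (T x) \<le> C * nrm V x"
    using bounded_linear_map_bound[OF T assms(2)] by blast
  have sn: "s n \<in> vecs V" for n using s(2) by auto
  have le: "nrm W (T (s n) - T x) \<le> C * nrm V (s n - x)" for n
    using bounded_linear_map_diff[OF T assms(2) sn x] C(2)[of "s n - x"] x sn by auto
  have ge: "0 \<le> nrm W (T (s n) - T x)" for n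
    using bounded_linear_mapD(1)[OF T] x sn by (intro W.nrm_nonneg W.diff_mem) auto
  have "(\<lambda>n. C * nrm V (s n - x)) \<longlonglongrightarrow> C * 0"
    using s by (intro tendsto_mult) (auto simp: converges_in_def)
  then have "(\<lambda>n. nrm W (T (s n) - T x)) \<longlonglongrightarrow> 0"
    by (intro LIMSEQ_squeeze_zero[OF _ ge le]) simp
  then show ?thesis using bounded_linear_mapD(1)[OF T] x by (simp add: converges_in_def)
qed

lemma bounded_linear_map_sums:
  assumes "bounded_linear_map V W T" "normed_space V" "normed_space W"
    and "sums_in V a x" "range a \<subseteq> vecs V"
  shows "sums_in W (\<lambda>n. T (a n)) (T x)"
proof -
  interpret V: normed V by unfold_locales fact
  have a: "a n \<in> vecs V" for n using assms(5) by auto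
  have "converges_in W (\<lambda>n. T (\<Sum>i<n. a i)) (T x)"
    using assms a by (intro bounded_linear_map_converges[OF assms(1-3)]) (auto simp: sums_in_def)
  moreover have "T (\<Sum>i<n. a i) = (\<Sum>i<n. T (a i))" for n
    using a by (intro bounded_linear_map_sum[OF assms(1,2)]) auto
  ultimately show ?thesis by (simp add: sums_in_def)
qed

lemma (in normed) bounded_linear_scal: "bounded_linear_map V V (scal V c)"
  unfolding bounded_linear_map_def
  by (auto simp: scale_right_distrib mult.commute intro!: exI[of _ "norm c"])

section \<open>Zabreiko's lemma\<close>

context banach_nspace
begin

text \<open>
  A metric must be symmetric on the whole type, while the norm is arbitrary outside \<open>vecs V\<close>.
\<close>

definition ndist :: "'b \<Rightarrow> 'b \<Rightarrow> real" where
  "ndist x y = (if x \<in> vecs V \<and> y \<in> vecs V then nrm V (x - y) else 0)"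

lemma Metric_space_ndist: "Metric_space (vecs V) ndist"
proof
  show "0 \<le> ndist x y" for x y by (auto simp: ndist_def)
  show "ndist x y = ndist y x" for x y by (auto simp: ndist_def nrm_minus_commute)
  show "ndist x y = 0 \<longleftrightarrow> x = y" if "x \<in> vecs V" "y \<in> vecs V" for x y
    using that nrm_eq_0[of "x - y"] by (auto simp: ndist_def)
  show "ndist x z \<le> ndist x y + ndist y z"
    if "x \<in> vecs V" "y \<in> vecs V" "z \<in> vecs V" for x y z
    using that nrm_triangle by (auto simp: ndist_def)
qed

interpretation M: Metric_space "vecs V" ndist by (rule Metric_space_ndist)

lemma mcomplete_ndist: "M.mcomplete"
  unfolding M.mcomplete_def
proof (intro allI impI)
  fix s assume s: "M.MCauchy s"
  then have sV: "range s \<subseteq> vecs V" and c: "\<forall>\<epsilon>>0. \<exists>N. \<forall>n n'. N \<le> n \<longrightarrow> N \<le> n' \<longrightarrow> ndist (s n) (s n') < \<epsilon>"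
    by (auto simp: M.MCauchy_def)
  have d: "ndist (s m) (s n) = nrm V (s m - s n)" for m n using sV by (auto simp: ndist_def)
  have "cauchy_in V s" using c unfolding cauchy_in_def d by blast
  then obtain x where x: "converges_in V s x" using cauchy_converges sV by blast
  have "limitin M.mtopology s x sequentially"
    unfolding M.limit_metric_sequentially
  proof (intro conjI allI impI)
    show "x \<in> vecs V" using x converges_in_mem by blast
    fix e :: real assume "e > 0"
    then obtain N where "\<And>n. n \<ge> N \<Longrightarrow> nrm V (s n - x) < e"
      using converges_inD[OF x _ sV] by blast
    then show "\<exists>N. \<forall>n\<ge>N. s n \<in> vecs V \<and> ndist (s n) x < e"
      using sV \<open>x \<in> vecs V\<close> by (intro exI[of _ N]) (auto simp: ndist_def)
  qed
  then show "\<exists>x. limitin M.mtopology s x sequentially" by blast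
qed

text \<open>
  By the Baire category theorem, the closure of one of countably many sets that cover the
  space has an interior point.
\<close>

lemma baire_dense_in_ball:
  assumes cover: "vecs V = (\<Union>k. A k)"
  obtains k :: nat and x r where "x \<in> vecs V" "r > 0"
    "\<And>y e. y \<in> vecs V \<Longrightarrow> nrm V (y - x) < r \<Longrightarrow> e > 0 \<Longrightarrow> \<exists>z\<in>A k. nrm V (y - z) < e"
proof -
  let ?G = "range (\<lambda>k. M.mtopology closure_of (A k))"
  have AV: "A k \<subseteq> vecs V" for k using cover by auto
  have "\<not> (\<forall>T\<in>?G. M.mtopology interior_of T = {})"
  proof
    assume *: "\<forall>T\<in>?G. M.mtopology interior_of T = {}"
    have "M.mtopology interior_of \<Union>?G = {}"
      by (rule M.metric_Baire_category_alt[OF mcomplete_ndist]) (use * in auto)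
    moreover have "\<Union>?G = vecs V"
    proof
      show "\<Union>?G \<subseteq> vecs V"
        using closure_of_subset_topspace[of M.mtopology] by auto
      have "A k \<subseteq> M.mtopology closure_of (A k)" for k
        using closure_of_subset[of "A k" M.mtopology] AV by simp
      then show "vecs V \<subseteq> \<Union>?G" unfolding cover by blast
    qed
    ultimately have "M.mtopology interior_of (topspace M.mtopology) = {}" by simp
    then have "topspace M.mtopology = {}" by (simp only: interior_of_topspace)
    then show False using zero_mem by auto
  qed
  then obtain k x where "x \<in> M.mtopology interior_of (M.mtopology closure_of (A k))" by auto
  then obtain r where x: "x \<in> vecs V" and r: "r > 0" "M.mball x r \<subseteq> M.mtopology closure_of (A k)"
    unfolding M.in_interior_of_mball by auto
  show thesis
  proof (rule that[OF x r(1)])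
    fix y and e :: real assume y: "y \<in> vecs V" "nrm V (y - x) < r" "e > 0"
    then have "y \<in> M.mball x r" using x by (auto simp: ndist_def nrm_minus_commute)
    then have "y \<in> M.mtopology closure_of (A k)" using r by auto
    then obtain z where "z \<in> A k" "z \<in> M.mball y e"
      using y(3) unfolding M.metric_closure_of by auto
    then show "\<exists>z\<in>A k. nrm V (y - z) < e"
      using y(1) AV by (intro bexI[of _ z]) (auto simp: ndist_def)
  qed
qed

text \<open>
  Zabreiko's lemma: a seminorm that is subadditive for convergent series is bounded. Some set
  \<open>{x. p x \<le> k}\<close> is dense in a ball, by Baire, hence in a ball around the origin; so every vector
  \<open>y\<close> has arbitrarily close approximations \<open>z\<close> with \<open>p z \<le> C * \<parallel>y\<parallel>\<close>. Approximating \<open>x\<close>, then the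
  error, and so on, writes \<open>x\<close> as a series whose terms have seminorms \<open>C * \<parallel>x\<parallel> / 2 ^ n\<close>.
\<close>

theorem zabreiko:
  fixes p :: "'b \<Rightarrow> real"
  assumes nonneg: "\<And>x. x \<in> vecs V \<Longrightarrow> 0 \<le> p x"
    and homog: "\<And>c x. x \<in> vecs V \<Longrightarrow> p (scal V c x) \<le> norm c * p x"
    and subadd: "\<And>x y. x \<in> vecs V \<Longrightarrow> y \<in> vecs V \<Longrightarrow> p (x + y) \<le> p x + p y"
    and csub: "\<And>x a. range a \<subseteq> vecs V \<Longrightarrow> sums_in V a x \<Longrightarrow> summable (\<lambda>n. p (a n)) \<Longrightarrow>
                 p x \<le> (\<Sum>n. p (a n))"
  obtains C where "C \<ge> 0" "\<And>x. x \<in> vecs V \<Longrightarrow> p x \<le> C * nrm V x"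
proof -
  have p0: "p 0 = 0"
    using homog[of 0 0] nonneg[of 0] by simp
  have pdiff: "p (x - y) \<le> p x + p y" if "x \<in> vecs V" "y \<in> vecs V" for x y
    using subadd[of x "- y"] homog[of y "-1"] that by (simp add: scale_minus_left)
  define A where "A k = {x \<in> vecs V. p x \<le> real k}" for k
  have "vecs V = (\<Union>k. A k)" unfolding A_def using real_arch_simple by auto
  then obtain k x0 r where x0: "x0 \<in> vecs V" and r: "r > 0" and
    dense: "\<And>y e. y \<in> vecs V \<Longrightarrow> nrm V (y - x0) < r \<Longrightarrow> e > 0 \<Longrightarrow> \<exists>z\<in>A k. nrm V (y - z) < e"
    by (rule baire_dense_in_ball) blast
  \<comment> \<open>Differences of points of \<open>A k\<close> approximate a ball around the origin.\<close>
  have origin: "\<exists>z\<in>vecs V. p z \<le> 2 * k \<and> nrm V (y - z) < e"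
    if y: "y \<in> vecs V" "nrm V y < r" and "e > 0" for y e
  proof -
    obtain z1 where z1: "z1 \<in> A k" "nrm V (x0 + y - z1) < e / 2"
      using dense[of "x0 + y" "e/2"] y x0 \<open>e > 0\<close> by auto
    obtain z2 where z2: "z2 \<in> A k" "nrm V (x0 - z2) < e / 2"
      using dense[of x0 "e/2"] r x0 \<open>e > 0\<close> by auto
    have zV: "z1 \<in> vecs V" "z2 \<in> vecs V" using z1 z2 by (auto simp: A_def)
    have eq: "y - (z1 - z2) = (x0 + y - z1) - (x0 - z2)" by simp
    have "nrm V (y - (z1 - z2)) \<le> nrm V (x0 + y - z1) + nrm V (x0 - z2)"
      unfolding eq using x0 y zV by (intro nrm_diff) auto
    then have "nrm V (y - (z1 - z2)) < e" using z1(2) z2(2) by linarith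
    moreover have "p (z1 - z2) \<le> 2 * k" using pdiff[OF zV] z1 z2 by (auto simp: A_def)
    ultimately show ?thesis using zV by blast
  qed
  define C where "C = 4 * real k / r"
  have C0: "C \<ge> 0" using r by (simp add: C_def)
  have approx: "\<exists>z\<in>vecs V. p z \<le> C * nrm V y \<and> nrm V (y - z) < e"
    if y: "y \<in> vecs V" and "e > 0" for y e
  proof (cases "y = 0")
    case True
    then show ?thesis using that p0 by (intro bexI[of _ 0]) auto
  next
    case False
    then have ny: "nrm V y > 0" using y nrm_eq_0[of y] nrm_nonneg[of y] by linarith
    define t where "t = r / (2 * nrm V y)"
    have t: "t > 0" using r ny by (simp add: t_def)
    have "t * nrm V y = r / 2" using ny by (simp add: t_def)
    then have ty: "scal V (of_real t) y \<in> vecs V" "nrm V (scal V (of_real t) y) < r"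
      using y t r by simp_all
    obtain z where z: "z \<in> vecs V" "p z \<le> 2 * k" "nrm V (scal V (of_real t) y - z) < t * e"
      using origin[OF ty, of "t * e"] t \<open>e > 0\<close> by auto
    let ?z = "scal V (of_real (1 / t)) z"
    have "y - ?z = scal V (of_real (1 / t)) (scal V (of_real t) y - z)"
      using t by (simp add: scale_right_diff_distrib flip: of_real_mult)
    then have "nrm V (y - ?z) = nrm V (scal V (of_real t) y - z) / t"
      using z(1) ty(1) t by (simp del: of_real_divide)
    then have near: "nrm V (y - ?z) < e" using z(3) t by (simp add: divide_less_eq mult.commute)
    have "p ?z \<le> (1 / t) * (2 * k)"
      using homog[OF z(1), of "of_real (1 / t)"] z(2) t
        mult_left_mono[OF z(2), of "1 / t"] by (simp del: of_real_divide)
    moreover have "(1 / t) * (2 * k) = C * nrm V y" by (simp add: t_def C_def)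
    ultimately have "p ?z \<le> C * nrm V y" by simp
    then show ?thesis using z(1) near by blast
  qed
  have "p x \<le> 2 * C * nrm V x" if x: "x \<in> vecs V" for x
  proof (cases "x = 0")
    case True then show ?thesis using p0 by simp
  next
    case False
    then have nx: "nrm V x > 0" using x nrm_eq_0[of x] nrm_nonneg[of x] by linarith
    \<comment> \<open>\<open>f n\<close> is the error that is left after \<open>n\<close> approximation steps.\<close>
    have "\<exists>f. \<forall>n. (f n \<in> vecs V \<and> nrm V (f n) \<le> nrm V x / 2 ^ n) \<and>
             p (f n - f (Suc n)) \<le> C * (nrm V x / 2 ^ n) \<and> (n = 0 \<longrightarrow> f n = x)"
    proof -
      let ?P = "\<lambda>n y. y \<in> vecs V \<and> nrm V y \<le> nrm V x / 2 ^ n \<and> (n = 0 \<longrightarrow> y = x)"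
      have "\<exists>f. \<forall>n. ?P n (f n) \<and> p (f n - f (Suc n)) \<le> C * (nrm V x / 2 ^ n)"
      proof (rule dependent_nat_choice)
        show "\<exists>y. ?P 0 y" using x by auto
        fix y n assume P: "?P n y"
        obtain z where z: "z \<in> vecs V" "p z \<le> C * nrm V y" "nrm V (y - z) < nrm V x / 2 ^ Suc n"
          using approx[of y "nrm V x / 2 ^ Suc n"] P nx by auto
        have "p z \<le> C * (nrm V x / 2 ^ n)"
          using z(2) P mult_left_mono[OF _ C0, of "nrm V y" "nrm V x / 2 ^ n"] by linarith
        then show "\<exists>y'. ?P (Suc n) y' \<and> p (y - y') \<le> C * (nrm V x / 2 ^ n)"
          using z P by (intro exI[of _ "y - z"]) auto
      qed
      then show ?thesis by blast
    qed
    then obtain f where f: "\<And>n. f n \<in> vecs V" "\<And>n. nrm V (f n) \<le> nrm V x / 2 ^ n"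
      "\<And>n. p (f n - f (Suc n)) \<le> C * (nrm V x / 2 ^ n)" "f 0 = x" by blast
    let ?a = "\<lambda>n. f n - f (Suc n)"
    have psum: "(\<Sum>i<n. ?a i) = x - f n" for n
      using f(4) by (induction n) (auto simp: algebra_simps)
    have "(\<lambda>n. nrm V x * (1 / 2) ^ n) \<longlonglongrightarrow> nrm V x * 0"
      by (intro tendsto_mult tendsto_const LIMSEQ_power_zero) auto
    then have "(\<lambda>n. nrm V x / 2 ^ n) \<longlonglongrightarrow> 0" by (simp add: power_divide)
    then have "(\<lambda>n. nrm V (f n)) \<longlonglongrightarrow> 0"
      by (rule LIMSEQ_squeeze_zero[OF _ nrm_nonneg[OF f(1)] f(2)])
    then have "sums_in V ?a x"
      using x f(1) by (simp add: sums_in_def converges_in_def psum)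
    moreover have geo: "(\<lambda>n. C * nrm V x * (1 / 2) ^ n) sums (C * nrm V x * (1 / (1 - 1 / 2)))"
      by (intro sums_mult geometric_sums) auto
    have pa: "p (?a n) \<le> C * nrm V x * (1 / 2) ^ n" for n
      using f(3)[of n] by (simp add: power_divide)
    have "summable (\<lambda>n. p (?a n))"
      using geo pa f(1) by (intro summable_comparison_test'[OF sums_summable[OF geo]])
        (auto simp: nonneg)
    ultimately have "p x \<le> (\<Sum>n. p (?a n))" using f(1) by (intro csub) auto
    also have "\<dots> \<le> (\<Sum>n. C * nrm V x * (1 / 2) ^ n)"
      using pa \<open>summable (\<lambda>n. p (?a n))\<close> geo sums_summable by (intro suminf_le) auto
    also have "\<dots> = 2 * C * nrm V x" using sums_unique[OF geo] by simp
    finally show ?thesis .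
  qed
  then show thesis using C0 that[of "2 * C"] by auto
qed

end

section \<open>Unconditional convergence\<close>

text \<open>
  A permutation of the naturals that lists, in each block \<open>{M k..<M (Suc k)}\<close>, the elements of
  \<open>F k\<close> first. Rearranged by it, a series has the sums over the sets \<open>F k\<close> as differences of
  partial sums.
\<close>

lemma block_permutation:
  fixes M :: "nat \<Rightarrow> nat"
  assumes M: "strict_mono M" "M 0 = 0" and F: "\<And>k. F k \<subseteq> {M k..<M (Suc k)}"
  obtains \<pi> where "bij \<pi>" "\<And>k. bij_betw \<pi> {M k..<M k + card (F k)} (F k)"
proof -
  let ?A = "\<lambda>k. {M k..<M k + card (F k)}" and ?B = "\<lambda>k. {M k..<M (Suc k)}"
  have AB: "?A k \<subseteq> ?B k" for k
    using card_mono[OF _ F, of k] by auto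
  have "\<exists>g. bij_betw g (?A k) (F k) \<and> bij_betw g (?B k) (?B k)" for k
  proof -
    have fin: "finite (F k)" using F finite_subset by blast
    have c: "card (?A k) = card (F k)" by simp
    have "card (?B k - ?A k) = card (?B k - F k)"
      using card_Diff_subset[OF _ AB, of k] card_Diff_subset[OF fin F] c by simp
    then obtain b where b: "bij_betw b (?B k - ?A k) (?B k - F k)"
      using finite_same_card_bij[of "?B k - ?A k" "?B k - F k"] by auto
    obtain a where a: "bij_betw a (?A k) (F k)"
      using finite_same_card_bij[OF _ fin c] by auto
    let ?g = "\<lambda>i. if i \<in> ?A k then a i else b i"
    have ga: "bij_betw ?g (?A k) (F k)" using a by (subst bij_betw_cong[of _ _ a]) auto
    have gb: "bij_betw ?g (?B k - ?A k) (?B k - F k)"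
      using b by (subst bij_betw_cong[of _ _ b]) auto
    have "bij_betw ?g (?A k \<union> (?B k - ?A k)) (F k \<union> (?B k - F k))"
      by (rule bij_betw_combine[OF ga gb]) auto
    moreover have "?A k \<union> (?B k - ?A k) = ?B k" "F k \<union> (?B k - F k) = ?B k"
      using AB F by blast+
    ultimately show ?thesis using ga by metis
  qed
  then obtain g where g: "\<And>k. bij_betw (g k) (?A k) (F k)" "\<And>k. bij_betw (g k) (?B k) (?B k)"
    by metis
  define \<kappa> where "\<kappa> i = (LEAST k. i < M (Suc k))" for i
  have \<kappa>: "i \<in> ?B (\<kappa> i)" for i
  proof -
    have "i < M (Suc i)" using strict_mono_imp_increasing[OF M(1), of "Suc i"] by simp
    then have 1: "i < M (Suc (\<kappa> i))" unfolding \<kappa>_def by (rule LeastI)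
    have "M (\<kappa> i) \<le> i"
    proof (cases "\<kappa> i")
      case (Suc j)
      then have "\<not> i < M (Suc j)" using not_less_Least[of j "\<lambda>k. i < M (Suc k)"] by (simp add: \<kappa>_def)
      then show ?thesis using Suc by simp
    qed (simp add: M)
    with 1 show ?thesis by simp
  qed
  have uniq: "j = k" if "i \<in> ?B j" "i \<in> ?B k" for i j k
  proof (rule ccontr)
    assume "j \<noteq> k"
    then consider "Suc j \<le> k" | "Suc k \<le> j" by linarith
    then show False
      using that strict_mono_mono[OF M(1)] by cases (auto dest!: monoD[of M])
  qed
  have \<kappa>_eq: "\<kappa> i = k" if "i \<in> ?B k" for i k using uniq[OF \<kappa> that] .
  let ?\<pi> = "\<lambda>i. g (\<kappa> i) i"
  have "bij_betw ?\<pi> (?B k) (?B k)" for k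
    by (subst bij_betw_cong[of _ _ "g k"]) (use \<kappa>_eq g(2) in auto)
  moreover have "disjoint_family_on ?B UNIV"
    using uniq unfolding disjoint_family_on_def by blast
  ultimately have "bij_betw ?\<pi> (\<Union>k. ?B k) (\<Union>k. ?B k)"
    by (intro bij_betw_UNION_disjoint) auto
  moreover have "(\<Union>k. ?B k) = UNIV" using \<kappa> by blast
  ultimately have "bij ?\<pi>" by simp
  moreover have "bij_betw ?\<pi> (?A k) (F k)" for k
    by (subst bij_betw_cong[of _ _ "g k"]) (use \<kappa>_eq g(1) AB in blast)+
  ultimately show thesis using that by blast
qed

context normed
begin

lemma unconditionally_sums_imp_sums: "unconditionally_sums_in V a x \<Longrightarrow> sums_in V a x"
  unfolding unconditionally_sums_in_def using bij_id by (metis comp_id)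

text \<open>
  Otherwise there are finite sets arbitrarily far out whose sums stay large, and successive
  blocks can be chosen around them; the permutation that lists these sets first in their
  blocks then gives a rearrangement whose partial sums are not a Cauchy sequence.
\<close>

lemma unconditional_small_tails:
  assumes a: "range a \<subseteq> vecs V" and un: "unconditionally_sums_in V a x" and "e > 0"
  obtains N where "\<And>F. finite F \<Longrightarrow> F \<subseteq> {N..} \<Longrightarrow> nrm V (sum a F) < e"
proof -
  have "\<exists>N. \<forall>F. finite F \<longrightarrow> F \<subseteq> {N..} \<longrightarrow> nrm V (sum a F) < e"
  proof (rule ccontr)
    assume "\<nexists>N. \<forall>F. finite F \<longrightarrow> F \<subseteq> {N..} \<longrightarrow> nrm V (sum a F) < e"
    then have "\<forall>N. \<exists>F. finite F \<and> F \<subseteq> {N..} \<and> nrm V (sum a F) \<ge> e" by (meson not_le)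
    then obtain G where G: "\<And>N. finite (G N)" "\<And>N. G N \<subseteq> {N..}" "\<And>N. nrm V (sum a (G N)) \<ge> e"
      by metis
    define M where "M = rec_nat 0 (\<lambda>_ m. Suc (Max (insert m (G m))))"
    have M0: "M 0 = 0" and MS: "M (Suc k) = Suc (Max (insert (M k) (G (M k))))" for k
      by (simp_all add: M_def)
    have Mge: "i < M (Suc k)" if "i \<in> insert (M k) (G (M k))" for i k
      using Max_ge[of "insert (M k) (G (M k))" i] that G(1) unfolding MS by (simp add: less_Suc_eq_le)
    have smono: "strict_mono M" by (rule strict_mono_Suc_iff[THEN iffD2]) (use Mge in blast)
    have F: "G (M k) \<subseteq> {M k..<M (Suc k)}" for k using G(2)[of "M k"] Mge by fastforce
    obtain \<pi> where \<pi>: "bij \<pi>" "\<And>k. bij_betw \<pi> {M k..<M k + card (G (M k))} (G (M k))"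
      using block_permutation[OF smono M0 F] by blast
    have mem: "(\<Sum>i\<in>A. (a \<circ> \<pi>) i) \<in> vecs V" for A
      using a by (intro sum_mem) auto
    have "sums_in V (a \<circ> \<pi>) x" using un \<pi>(1) unfolding unconditionally_sums_in_def by blast
    then have "cauchy_in V (\<lambda>n. \<Sum>i<n. (a \<circ> \<pi>) i)"
      unfolding sums_in_def by (rule converges_in_cauchy) (use mem in auto)
    then obtain N where N: "\<And>m n. m \<ge> N \<Longrightarrow> n \<ge> N \<Longrightarrow>
        nrm V ((\<Sum>i<m. (a \<circ> \<pi>) i) - (\<Sum>i<n. (a \<circ> \<pi>) i)) < e"
      using \<open>e > 0\<close> unfolding cauchy_in_def by blast
    let ?c = "M N + card (G (M N))"
    have "M N \<ge> N" using strict_mono_imp_increasing[OF smono] .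
    then have "nrm V ((\<Sum>i<?c. (a \<circ> \<pi>) i) - (\<Sum>i<M N. (a \<circ> \<pi>) i)) < e" by (intro N) auto
    moreover have "(\<Sum>i<?c. (a \<circ> \<pi>) i) - (\<Sum>i<M N. (a \<circ> \<pi>) i) = (\<Sum>i\<in>{M N..<?c}. (a \<circ> \<pi>) i)"
      using sum_diff_nat_ivl[of 0 "M N" ?c "a \<circ> \<pi>"] by (simp add: lessThan_atLeast0)
    moreover have "(\<Sum>i\<in>{M N..<?c}. (a \<circ> \<pi>) i) = sum a (G (M N))"
      using sum.reindex_bij_betw[OF \<pi>(2), of a N] by simp
    ultimately show False using G(3)[of "M N"] by simp
  qed
  then show thesis using that by blast
qed

text \<open>
  A sum with coefficients in the unit interval is a convex combination of subsums.
\<close>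

lemma unit_interval_multipliers:
  assumes "finite A" "\<And>i. i \<in> A \<Longrightarrow> y i \<in> vecs V" "\<And>i. i \<in> A \<Longrightarrow> 0 \<le> t i \<and> t i \<le> 1"
    and "z \<in> vecs V" and "\<And>B. B \<subseteq> A \<Longrightarrow> nrm V (z + sum y B) \<le> c"
  shows "nrm V (z + (\<Sum>i\<in>A. scal V (of_real (t i)) (y i))) \<le> c"
  using assms
proof (induction A arbitrary: z rule: finite_induct)
  case empty
  then show ?case by simp
next
  case (insert k A)
  let ?z = "z + scal V (of_real (t k)) (y k)"
  have yk: "y k \<in> vecs V" using insert by auto
  have "nrm V (?z + sum y B) \<le> c" if "B \<subseteq> A" for B
  proof -
    have B: "sum y B \<in> vecs V" using that insert by (intro sum_mem) auto
    have kB: "k \<notin> B" "finite B" using that insert finite_subset by auto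
    have 1: "nrm V (z + y k + sum y B) \<le> c"
      using insert.prems(4)[of "insert k B"] that kB by (auto simp add: add.assoc)
    have 2: "nrm V (z + sum y B) \<le> c"
      using insert.prems(4)[of B] that by auto
    have eq: "?z + sum y B = scal V (of_real (t k)) (z + y k + sum y B)
        + scal V (of_real (1 - t k)) (z + sum y B)"
      by (simp add: scale_right_distrib scale_left_diff_distrib)
    show ?thesis unfolding eq
      by (rule scal_of_real_convex) (use 1 2 B yk insert.prems in auto)
  qed
  then have "nrm V (?z + (\<Sum>i\<in>A. scal V (of_real (t i)) (y i))) \<le> c"
    using insert.prems yk by (intro insert.IH) auto
  then show ?case using insert.hyps by (simp add: add.assoc)
qed

end

text \<open>
  Scalars are split into real coordinates and these into positive and negative parts, which
  explains the factor \<open>2 * DIM('k)\<close>.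
\<close>

lemma scalar_multipliers:
  fixes V :: "('k::{real_normed_field,euclidean_space}, 'a::ab_group_add) nspace"
    and A :: "'i set" and c :: real
  assumes "normed_space V" "finite A" and y: "\<And>i. i \<in> A \<Longrightarrow> y i \<in> vecs V"
    and \<epsilon>: "\<And>i. i \<in> A \<Longrightarrow> norm (\<epsilon> i) \<le> 1"
    and c: "\<And>B. B \<subseteq> A \<Longrightarrow> nrm V (sum y B) \<le> c"
  shows "nrm V (\<Sum>i\<in>A. scal V (\<epsilon> i) (y i)) \<le> 2 * DIM('k) * c"
proof -
  interpret normed V by unfold_locales fact
  let ?P = "\<lambda>t. \<Sum>i\<in>A. scal V (of_real (t i)) (y i)"
  have P: "nrm V (?P t) \<le> c" "?P t \<in> vecs V" if "\<And>i. i \<in> A \<Longrightarrow> 0 \<le> t i \<and> t i \<le> 1" for t :: "'i \<Rightarrow> real"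
    using unit_interval_multipliers[OF assms(2) y that, where z = 0 and c = c] c y by (simp_all add: sum_mem)
  have PP: "?P t \<in> vecs V" for t :: "'i \<Rightarrow> real" using y by (intro sum_mem) auto
  have comp: "\<bar>\<epsilon> i \<bullet> \<beta>\<bar> \<le> 1" if "i \<in> A" "\<beta> \<in> Basis" for i \<beta>
    using Basis_le_norm[OF that(2), of "\<epsilon> i"] \<epsilon>[OF that(1)] by linarith
  have "scal V (\<epsilon> i) (y i) = (\<Sum>\<beta>\<in>Basis. scal V \<beta> (scal V (of_real (\<epsilon> i \<bullet> \<beta>)) (y i)))" for i
    apply (subst euclidean_representation[of "\<epsilon> i", symmetric])
    by (simp add: scale_sum_left scaleR_conv_of_real mult.commute)
  then have "(\<Sum>i\<in>A. scal V (\<epsilon> i) (y i)) = (\<Sum>\<beta>\<in>Basis. scal V \<beta> (?P (\<lambda>i. \<epsilon> i \<bullet> \<beta>)))"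
    by (simp add: sum.swap[of _ Basis A] scale_sum_right del: scale_scale)
  also have "nrm V \<dots> \<le> (\<Sum>\<beta>\<in>(Basis :: 'k set). 2 * c)"
  proof (rule order_trans[OF nrm_sum sum_mono])
    fix \<beta> :: 'k assume \<beta>: "\<beta> \<in> Basis"
    let ?p = "\<lambda>i. max 0 (\<epsilon> i \<bullet> \<beta>)" and ?n = "\<lambda>i. max 0 (- (\<epsilon> i \<bullet> \<beta>))"
    have "of_real (\<epsilon> i \<bullet> \<beta>) = (of_real (?p i) - of_real (?n i) :: 'k)" for i
      by (auto simp: max_def)
    then have eq: "?P (\<lambda>i. \<epsilon> i \<bullet> \<beta>) = ?P ?p - ?P ?n"
      by (simp add: scale_left_diff_distrib sum_subtractf)
    have "nrm V (?P ?p - ?P ?n) \<le> nrm V (?P ?p) + nrm V (?P ?n)"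
      using PP by (intro nrm_diff) auto
    also have "\<dots> \<le> c + c"
      using comp[OF _ \<beta>] by (intro add_mono P(1)) (auto simp: abs_le_iff)
    finally show "nrm V (scal V \<beta> (?P (\<lambda>i. \<epsilon> i \<bullet> \<beta>))) \<le> 2 * c"
      using \<beta> PP[of ?p] PP[of ?n] unfolding eq by simp
  qed (use PP in auto)
  finally show ?thesis by simp
qed

section \<open>Uniform boundedness and unconditional frames\<close>

text \<open>
  The supremum of the norms \<open>\<parallel>T x\<parallel>\<close> is a seminorm to which Zabreiko's lemma applies.
\<close>

theorem uniform_boundedness:
  assumes "banach_space V" and W: "normed_space W" and "\<T> \<noteq> {}"
    and lin: "\<And>T. T \<in> \<T> \<Longrightarrow> bounded_linear_map V W T"
    and pointwise: "\<And>x. x \<in> vecs V \<Longrightarrow> \<exists>b. \<forall>T\<in>\<T>. nrm W (T x) \<le> b"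
  obtains C where "C \<ge> 0" "\<And>T x. T \<in> \<T> \<Longrightarrow> x \<in> vecs V \<Longrightarrow> nrm W (T x) \<le> C * nrm V x"
proof -
  interpret V: banach_nspace V by (rule banach_nspaceI) fact
  interpret W: normed W by unfold_locales fact
  define p where "p x = (SUP T\<in>\<T>. nrm W (T x))" for x
  have bdd: "bdd_above ((\<lambda>T. nrm W (T x)) ` \<T>)" if "x \<in> vecs V" for x
    using pointwise[OF that] by (auto simp: bdd_above_def)
  have le_p: "nrm W (T x) \<le> p x" if "x \<in> vecs V" "T \<in> \<T>" for x T
    unfolding p_def by (rule cSUP_upper[OF that(2) bdd[OF that(1)]])
  have p_le: "p x \<le> b" if "\<And>T. T \<in> \<T> \<Longrightarrow> nrm W (T x) \<le> b" for x b
    unfolding p_def by (rule cSUP_least) (use assms(3) that in auto)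
  note mem = bounded_linear_mapD(1)[OF lin]
  have p0: "0 \<le> p x" if "x \<in> vecs V" for x
    using assms(3) le_p[OF that] W.nrm_nonneg[OF mem] that by (meson ex_in_conv order_trans)
  have "\<exists>C\<ge>0. \<forall>x\<in>vecs V. p x \<le> C * nrm V x"
  proof (rule V.zabreiko[of p])
    show "p (scal V c x) \<le> norm c * p x" if "x \<in> vecs V" for c x
    proof (rule p_le)
      fix T assume T: "T \<in> \<T>"
      have "nrm W (T (scal V c x)) = norm c * nrm W (T x)"
        using bounded_linear_mapD(3)[OF lin[OF T] that] mem[OF T that] by simp
      also have "\<dots> \<le> norm c * p x" using le_p[OF that T] by (simp add: mult_left_mono)
      finally show "nrm W (T (scal V c x)) \<le> norm c * p x" .
    qed
    show "p (x + y) \<le> p x + p y" if "x \<in> vecs V" "y \<in> vecs V" for x y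
    proof (rule p_le)
      fix T assume T: "T \<in> \<T>"
      have "nrm W (T (x + y)) \<le> nrm W (T x) + nrm W (T y)"
        using bounded_linear_mapD(2)[OF lin[OF T] that] W.nrm_add[OF mem[OF T] mem[OF T]] that by simp
      then show "nrm W (T (x + y)) \<le> p x + p y"
        using le_p[OF that(1) T] le_p[OF that(2) T] by linarith
    qed
    show "p x \<le> (\<Sum>n. p (a n))"
      if a: "range a \<subseteq> vecs V" "sums_in V a x" "summable (\<lambda>n. p (a n))" for x a
    proof (rule p_le)
      fix T assume T: "T \<in> \<T>"
      have an: "a n \<in> vecs V" for n using a by auto
      have "sums_in W (\<lambda>n. T (a n)) (T x)"
        by (rule bounded_linear_map_sums[OF lin[OF T] V.normed_space W a(2,1)])
      then show "nrm W (T x) \<le> (\<Sum>n. p (a n))"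
        unfolding sums_in_def
      proof (rule W.nrm_limit_le[where N = 0])
        show "range (\<lambda>n. \<Sum>i<n. T (a i)) \<subseteq> vecs W"
          using mem[OF T an] by (auto intro: W.sum_mem)
        fix n
        have "nrm W (\<Sum>i<n. T (a i)) \<le> (\<Sum>i<n. nrm W (T (a i)))"
          using mem[OF T an] by (intro W.nrm_sum) auto
        also have "\<dots> \<le> (\<Sum>i<n. p (a i))" by (intro sum_mono le_p an T)
        also have "\<dots> \<le> (\<Sum>n. p (a n))" using a(3) p0 an by (intro sum_le_suminf) auto
        finally show "nrm W (\<Sum>i<n. T (a i)) \<le> (\<Sum>n. p (a n))" .
      qed
    qed
  qed (use p0 in auto)
  then obtain C where "C \<ge> 0" "\<forall>x\<in>vecs V. p x \<le> C * nrm V x" by blast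
  then show thesis using that le_p by (meson order_trans)
qed

lemma bounded_linear_map_rank_one:
  assumes "f \<in> topological_dual V" "normed_space V" "normed_space W" "v \<in> vecs W"
  shows "bounded_linear_map V W (\<lambda>x. scal W (f x) v)"
proof -
  interpret W: normed W by unfold_locales fact
  have f: "bounded_linear_map V scalar_space f" using assms by (simp add: topological_dual_def)
  obtain C where C: "C \<ge> 0" "\<And>x. x \<in> vecs V \<Longrightarrow> norm (f x) \<le> C * nrm V x"
    using bounded_linear_map_bound[OF f assms(2)] by (auto simp: scalar_space_def)
  have "nrm W (scal W (f x) v) \<le> (C * nrm W v) * nrm V x" if "x \<in> vecs V" for x
    using mult_right_mono[OF C(2)[OF that], of "nrm W v"] assms(4) by (simp add: mult_ac)
  then show ?thesis
    using bounded_linear_mapD[OF f] assms(4) unfolding bounded_linear_map_def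
    by (auto simp: scalar_space_def W.scale_left_distrib)
qed

lemma bounded_linear_map_sum_maps:
  assumes "finite A" "\<And>i. i \<in> A \<Longrightarrow> bounded_linear_map V W (T i)" "normed_space V" "normed_space W"
  shows "bounded_linear_map V W (\<lambda>x. \<Sum>i\<in>A. T i x)"
proof -
  interpret V: normed V by unfold_locales fact
  interpret W: normed W by unfold_locales fact
  note D = bounded_linear_mapD[OF assms(2)]
  have "\<forall>i\<in>A. \<exists>C. \<forall>x\<in>vecs V. nrm W (T i x) \<le> C * nrm V x"
    using assms(2) unfolding bounded_linear_map_def by blast
  then obtain C where C: "\<And>i x. i \<in> A \<Longrightarrow> x \<in> vecs V \<Longrightarrow> nrm W (T i x) \<le> C i * nrm V x" by metis
  have bound: "nrm W (\<Sum>i\<in>A. T i x) \<le> (\<Sum>i\<in>A. C i) * nrm V x" if "x \<in> vecs V" for x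
  proof -
    have "nrm W (\<Sum>i\<in>A. T i x) \<le> (\<Sum>i\<in>A. nrm W (T i x))" by (rule W.nrm_sum) (rule D(1)[OF _ that])
    also have "\<dots> \<le> (\<Sum>i\<in>A. C i * nrm V x)" by (intro sum_mono C that)
    finally show ?thesis by (simp add: sum_distrib_right)
  qed
  show ?thesis
    unfolding bounded_linear_map_def
    using D bound by (auto simp: sum.distrib W.scale_sum_right intro!: W.sum_mem exI[of _ "sum C A"])
qed

locale frame = banach_nspace X
  for X :: "('k::{real_normed_field,euclidean_space}, 'a::ab_group_add) nspace" +
  fixes v :: "nat \<Rightarrow> 'a" and f :: "nat \<Rightarrow> 'a \<Rightarrow> 'k"
  assumes v_mem: "v n \<in> vecs X" and f_dual: "f n \<in> topological_dual X"
    and expansion: "x \<in> vecs X \<Longrightarrow> unconditionally_sums_in X (\<lambda>n. scal X (f n x) (v n)) x"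
begin

lemma term_mem: "scal X c (v n) \<in> vecs X" using v_mem by blast

text \<open>
  The tails are small uniformly in the multipliers \<open>\<epsilon>\<close>. This uniformity is what puts the
  coefficient sequence of \<open>x\<close> into the closure of the finitely supported sequences.
\<close>

lemma multiplier_small_tails:
  assumes x: "x \<in> vecs X" and "e > 0"
  obtains N where "\<And>A \<epsilon>. finite A \<Longrightarrow> A \<subseteq> {N..} \<Longrightarrow> (\<And>i. norm (\<epsilon> i) \<le> 1) \<Longrightarrow>
    nrm X (\<Sum>i\<in>A. scal X (\<epsilon> i * f i x) (v i)) \<le> e"
proof -
  define d where "d = 2 * real DIM('k)"
  have d: "d > 0" by (simp add: d_def)
  have r: "range (\<lambda>n. scal X (f n x) (v n)) \<subseteq> vecs X" using term_mem by blast
  have "e / d > 0" using d \<open>e > 0\<close> by simp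
  then obtain N where N: "\<And>F. finite F \<Longrightarrow> F \<subseteq> {N..} \<Longrightarrow>
      nrm X (\<Sum>n\<in>F. scal X (f n x) (v n)) < e / d"
    using unconditional_small_tails[OF r expansion[OF x]] by blast
  show thesis
  proof (rule that)
    fix A :: "nat set" and \<epsilon> :: "nat \<Rightarrow> 'k"
    assume A: "finite A" "A \<subseteq> {N..}" and \<epsilon>: "\<And>i. norm (\<epsilon> i) \<le> 1"
    have "nrm X (\<Sum>i\<in>A. scal X (\<epsilon> i) (scal X (f i x) (v i))) \<le> 2 * DIM('k) * (e / d)"
    proof (rule scalar_multipliers[OF normed_space A(1) term_mem \<epsilon>])
      fix B assume "B \<subseteq> A"
      then show "nrm X (\<Sum>n\<in>B. scal X (f n x) (v n)) \<le> e / d"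
        using A N[of B] finite_subset[of B A] by force
    qed
    then show "nrm X (\<Sum>i\<in>A. scal X (\<epsilon> i * f i x) (v i)) \<le> e"
      using d by (simp add: d_def)
  qed
qed

lemma multiplier_bound:
  obtains K where "K \<ge> 0" "\<And>A \<epsilon> x. finite A \<Longrightarrow> x \<in> vecs X \<Longrightarrow> (\<And>i. norm (\<epsilon> i) \<le> 1) \<Longrightarrow>
    nrm X (\<Sum>i\<in>A. scal X (\<epsilon> i * f i x) (v i)) \<le> K * nrm X x"
proof -
  define \<T> where "\<T> = {\<lambda>x. \<Sum>i\<in>A. scal X (\<epsilon> i * f i x) (v i) | A \<epsilon>. finite A \<and> (\<forall>i. norm (\<epsilon> i) \<le> 1)}"
  have "\<exists>K\<ge>0. \<forall>T\<in>\<T>. \<forall>x\<in>vecs X. nrm X (T x) \<le> K * nrm X x"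
  proof (rule uniform_boundedness[OF banach normed_space, of \<T>])
    show "\<T> \<noteq> {}" by (auto simp: \<T>_def intro!: exI[of _ "{}"] exI[of _ "\<lambda>_. 0"])
    fix T assume "T \<in> \<T>"
    then obtain A \<epsilon> where T: "T = (\<lambda>x. \<Sum>i\<in>A. scal X (f i x) (scal X (\<epsilon> i) (v i)))" "finite A"
      by (auto simp: \<T>_def mult.commute)
    show "bounded_linear_map X X T"
      unfolding T(1)
      by (intro bounded_linear_map_sum_maps T(2) normed_space bounded_linear_map_rank_one f_dual term_mem)
  next
    fix x assume x: "x \<in> vecs X"
    obtain N where N: "\<And>A \<epsilon>. finite A \<Longrightarrow> A \<subseteq> {N..} \<Longrightarrow> (\<And>i. norm (\<epsilon> i) \<le> 1) \<Longrightarrow>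
        nrm X (\<Sum>i\<in>A. scal X (\<epsilon> i * f i x) (v i)) \<le> 1"
      using multiplier_small_tails[OF x, of 1] by auto
    \<comment> \<open>Beyond \<open>N\<close> all multiplied sums have norm at most 1; the finitely many earlier terms are added.\<close>
    let ?b = "(\<Sum>i<N. nrm X (scal X (f i x) (v i))) + 1"
    have "nrm X (\<Sum>i\<in>A. scal X (\<epsilon> i * f i x) (v i)) \<le> ?b"
      if A: "finite A" and \<epsilon>: "\<And>i. norm (\<epsilon> i) \<le> 1" for A :: "nat set" and \<epsilon>
    proof -
      let ?y = "\<lambda>i. scal X (\<epsilon> i * f i x) (v i)"
      have "sum ?y A = sum ?y (A \<inter> {..<N}) + sum ?y (A - {..<N})"
        using A by (rule sum.Int_Diff)
      then have "nrm X (sum ?y A) \<le> nrm X (sum ?y (A \<inter> {..<N})) + nrm X (sum ?y (A - {..<N}))"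
        using nrm_add[OF sum_mem sum_mem, OF term_mem term_mem] by simp
      moreover have "nrm X (sum ?y (A \<inter> {..<N})) \<le> (\<Sum>i\<in>A \<inter> {..<N}. nrm X (?y i))"
        by (intro nrm_sum term_mem)
      moreover have "(\<Sum>i\<in>A \<inter> {..<N}. nrm X (?y i)) \<le> (\<Sum>i\<in>A \<inter> {..<N}. nrm X (scal X (f i x) (v i)))"
      proof (rule sum_mono)
        fix i
        have "norm (\<epsilon> i) * (norm (f i x) * nrm X (v i)) \<le> 1 * (norm (f i x) * nrm X (v i))"
          using \<epsilon>[of i] v_mem by (intro mult_right_mono) auto
        then show "nrm X (?y i) \<le> nrm X (scal X (f i x) (v i))"
          using v_mem by (simp add: norm_mult mult.assoc)
      qed
      moreover have "\<dots> \<le> (\<Sum>i<N. nrm X (scal X (f i x) (v i)))"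
        using term_mem by (intro sum_mono2) auto
      moreover have "nrm X (sum ?y (A - {..<N})) \<le> 1" using A \<epsilon> by (intro N) auto
      ultimately show ?thesis by linarith
    qed
    then show "\<exists>b. \<forall>T\<in>\<T>. nrm X (T x) \<le> b"
      by (intro exI[of _ ?b]) (auto simp: \<T>_def)
  qed blast
  then obtain K where K: "K \<ge> 0" "\<forall>T\<in>\<T>. \<forall>x\<in>vecs X. nrm X (T x) \<le> K * nrm X x" by blast
  show thesis
  proof (rule that[OF K(1)])
    fix A :: "nat set" and x and \<epsilon> :: "nat \<Rightarrow> 'k"
    assume *: "finite A" "x \<in> vecs X" "\<And>i. norm (\<epsilon> i) \<le> 1"
    then have "(\<lambda>x. \<Sum>i\<in>A. scal X (\<epsilon> i * f i x) (v i)) \<in> \<T>" by (auto simp: \<T>_def)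
    from bspec[OF bspec[OF K(2) this] *(2)]
    show "nrm X (\<Sum>i\<in>A. scal X (\<epsilon> i * f i x) (v i)) \<le> K * nrm X x" .
  qed
qed

end

section \<open>Hahn-Banach for a sublinear functional\<close>

context
  fixes s :: "real \<Rightarrow> 'v \<Rightarrow> 'v::ab_group_add"
  assumes s: "vector_space s"
begin

interpretation vector_space s by (rule s)

definition sublinear :: "('v \<Rightarrow> real) \<Rightarrow> bool" where
  "sublinear q \<longleftrightarrow> (\<forall>x y. q (x + y) \<le> q x + q y) \<and> (\<forall>r>0. \<forall>x. q (s r x) \<le> r * q x)"

text \<open>
  Among the sublinear functionals below \<open>q\<close> that satisfy \<open>r (- b) = - q b\<close>, the largest one.
  It shows that a minimal sublinear functional is odd.
\<close>

definition tilt :: "'v \<Rightarrow> ('v \<Rightarrow> real) \<Rightarrow> 'v \<Rightarrow> real" where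
  "tilt b q x = (INF t\<in>{0..}. q (x + s t b) - t * q b)"

lemma sublinear_zero: assumes "sublinear q" shows "q 0 = 0"
proof -
  have "q (s r 0) \<le> r * q 0" if "r > 0" for r using assms that unfolding sublinear_def by blast
  from this[of 2] this[of "1/2"] show ?thesis by simp
qed

lemma sublinear_minus: assumes "sublinear q" shows "- q (- x) \<le> q x"
proof -
  have "q (x + - x) \<le> q x + q (- x)" using assms unfolding sublinear_def by blast
  then show ?thesis using sublinear_zero[OF assms] by simp
qed

lemma sublinear_scale: assumes "sublinear q" "r \<ge> 0" shows "q (s r x) = r * q x"
proof (cases "r = 0")
  case True then show ?thesis using sublinear_zero[OF assms(1)] by simp
next
  case False
  then have r: "r > 0" using assms by simp
  have *: "q (s r x) \<le> r * q x" if "r > 0" for r x using assms that unfolding sublinear_def by blast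
  have "q x \<le> (1 / r) * q (s r x)" using *[of "1 / r" "s r x"] r by simp
  then have "r * q x \<le> q (s r x)" using r by (simp add: field_simps)
  with *[OF r, of x] show ?thesis by simp
qed

lemma tilt_sublinear:
  assumes q: "sublinear q"
  shows "sublinear (tilt b q)" "tilt b q \<le> q" "tilt b q (- b) \<le> - q b"
proof -
  have add: "q (x + y) \<le> q x + q y" for x y using q unfolding sublinear_def by blast
  have "- q (- x) \<le> q (x + s t b) - t * q b" if "t \<ge> 0" for x t
    using add[of "x + s t b" "- x"] sublinear_scale[OF q that, of b] by simp
  then have bdd: "bdd_below ((\<lambda>t. q (x + s t b) - t * q b) ` {0..})" for x
    by (intro bdd_belowI2[of _ "- q (- x)"]) auto
  have le: "tilt b q x \<le> q (x + s t b) - t * q b" if "t \<ge> 0" for x t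
    unfolding tilt_def by (rule cINF_lower[OF bdd]) (use that in simp)
  have ge: "c \<le> tilt b q x" if "\<And>t. t \<ge> 0 \<Longrightarrow> c \<le> q (x + s t b) - t * q b" for c x
    unfolding tilt_def by (rule cINF_greatest) (use that in auto)
  show "tilt b q \<le> q" using le[of 0] by (auto simp: le_fun_def)
  show "tilt b q (- b) \<le> - q b" using le[of 1 "- b"] sublinear_zero[OF q] by simp
  have two: "tilt b q (x + y) \<le> (q (x + s t b) - t * q b) + (q (y + s u b) - u * q b)"
    if "t \<ge> 0" "u \<ge> 0" for x y t u
  proof -
    have eq: "x + y + s (t + u) b = (x + s t b) + (y + s u b)"
      by (simp add: scale_left_distrib ac_simps)
    show ?thesis
      using le[of "t + u" "x + y"] add[of "x + s t b" "y + s u b"] that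
      unfolding eq by (simp add: algebra_simps)
  qed
  have "tilt b q (x + y) - tilt b q x \<le> tilt b q y" for x y
  proof (rule ge)
    fix u :: real assume u: "u \<ge> 0"
    have "tilt b q (x + y) - (q (y + s u b) - u * q b) \<le> tilt b q x"
    proof (rule ge)
      fix t :: real assume "t \<ge> 0"
      from two[OF this u, of x y]
      show "tilt b q (x + y) - (q (y + s u b) - u * q b) \<le> q (x + s t b) - t * q b" by simp
    qed
    then show "tilt b q (x + y) - tilt b q x \<le> q (y + s u b) - u * q b" by simp
  qed
  moreover have "tilt b q (s r x) \<le> r * tilt b q x" if r: "r > 0" for r x
  proof -
    have "tilt b q (s r x) / r \<le> tilt b q x"
    proof (rule ge)
      fix t :: real assume t: "t \<ge> 0"
      have "s r x + s (r * t) b = s r (x + s t b)" by (simp add: scale_right_distrib)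
      then have "tilt b q (s r x) \<le> r * (q (x + s t b) - t * q b)"
        using le[of "r * t" "s r x"] sublinear_scale[OF q, of r "x + s t b"] r t
        by (simp add: algebra_simps)
      then show "tilt b q (s r x) / r \<le> q (x + s t b) - t * q b" using r by (simp add: field_simps)
    qed
    then show ?thesis using r by (simp add: field_simps)
  qed
  ultimately show "sublinear (tilt b q)"
    unfolding sublinear_def by (metis diff_le_eq add.commute)
qed

text \<open>
  The pointwise infimum of a chain of sublinear functionals below \<open>p\<close> is finite, as
  \<open>- p (- x)\<close> bounds it from below, and it is again sublinear.
\<close>

lemma minimal_sublinear:
  assumes p: "sublinear p"
  obtains m where "sublinear m" "m \<le> p" "\<And>q. sublinear q \<Longrightarrow> q \<le> m \<Longrightarrow> q = m"
proof -
  let ?A = "{q. sublinear q \<and> q \<le> p}"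
  have "\<exists>m\<in>?A. \<forall>q\<in>?A. q \<le> m \<longrightarrow> q = m"
  proof (rule predicate_Zorn)
    show "partial_order_on ?A (relation_of (\<lambda>q r. r \<le> q) ?A)"
      by (auto simp: partial_order_on_def preorder_on_def refl_on_def trans_def antisym_def relation_of_def)
    fix C assume "C \<in> Chains (relation_of (\<lambda>q r. r \<le> q) ?A)"
    then have CA: "C \<subseteq> ?A" and comp: "\<And>q r. q \<in> C \<Longrightarrow> r \<in> C \<Longrightarrow> q \<le> r \<or> r \<le> q"
      by (auto simp: Chains_def relation_of_def)
    show "\<exists>u\<in>?A. \<forall>q\<in>C. u \<le> q"
    proof (cases "C = {}")
      case True then show ?thesis using p by auto
    next
      case False
      define u where "u x = (INF q\<in>C. q x)" for x
      have "- p (- x) \<le> q x" if "q \<in> C" for q x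
      proof -
        have "sublinear q" "q (- x) \<le> p (- x)" using CA that by (auto simp: le_fun_def)
        then show ?thesis using sublinear_minus[of q x] by simp
      qed
      then have bdd: "bdd_below ((\<lambda>q. q x) ` C)" for x by (intro bdd_belowI2) auto
      have le: "u x \<le> q x" if "q \<in> C" for q x
        unfolding u_def by (rule cINF_lower[OF bdd that])
      have ge: "c \<le> u x" if "\<And>q. q \<in> C \<Longrightarrow> c \<le> q x" for c x
        unfolding u_def by (rule cINF_greatest) (use that False in auto)
      have add: "u (x + y) \<le> u x + u y" for x y
      proof -
        have two: "u (x + y) \<le> q x + r y" if qr: "q \<in> C" "r \<in> C" for q r
        proof -
          obtain m where m: "m \<in> C" "m \<le> q" "m \<le> r" using comp[OF qr] qr by blast
          have "u (x + y) \<le> m (x + y)" by (rule le) fact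
          also have "\<dots> \<le> m x + m y" using m CA by (auto simp: sublinear_def)
          also have "\<dots> \<le> q x + r y" using m by (intro add_mono) (auto simp: le_fun_def)
          finally show ?thesis .
        qed
        have "u (x + y) - u x \<le> u y"
        proof (rule ge)
          fix r assume r: "r \<in> C"
          have "u (x + y) - r y \<le> u x"
          proof (rule ge)
            fix q assume "q \<in> C"
            from two[OF this r] show "u (x + y) - r y \<le> q x" by simp
          qed
          then show "u (x + y) - u x \<le> r y" by simp
        qed
        then show ?thesis by simp
      qed
      have "u (s r x) \<le> r * u x" if r: "r > 0" for r x
      proof -
        have "u (s r x) / r \<le> u x"
        proof (rule ge)
          fix q assume q: "q \<in> C"
          then have "q (s r x) \<le> r * q x" using CA r by (auto simp: sublinear_def)
          then show "u (s r x) / r \<le> q x" using le[OF q, of "s r x"] r by (simp add: field_simps)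
        qed
        then show ?thesis using r by (simp add: field_simps)
      qed
      then have "sublinear u" using add by (simp add: sublinear_def)
      moreover have "u \<le> q" if "q \<in> C" for q using le[OF that] by (simp add: le_fun_def)
      moreover have "u \<le> p" using calculation(2) False CA by (metis (lifting) ex_in_conv mem_Collect_eq order_trans subsetD)
      ultimately show ?thesis by blast
    qed
  qed
  then show thesis using that by (smt (verit, best) mem_Collect_eq order_trans)
qed

text \<open>
  A minimal sublinear functional is not changed by tilting, so it is odd and hence linear. It is
  taken below \<open>tilt a p\<close>, whose value at \<open>- a\<close> forces the value \<open>p a\<close> at \<open>a\<close>.
\<close>

theorem hahn_banach:
  assumes p: "sublinear p"
  obtains g where "\<And>x y. g (x + y) = g x + g y" "\<And>r x. g (s r x) = r * g x"
    "\<And>x. g x \<le> p x" "g a = p a"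
proof -
  obtain m where m: "sublinear m" "m \<le> tilt a p" "\<And>q. sublinear q \<Longrightarrow> q \<le> m \<Longrightarrow> q = m"
    using minimal_sublinear[OF tilt_sublinear(1)[OF p]] by blast
  have odd: "m (- b) = - m b" for b
  proof -
    have "tilt b m = m" using tilt_sublinear(1,2)[OF m(1)] m(3) by blast
    then have "m (- b) \<le> - m b" using tilt_sublinear(3)[OF m(1), of b] by simp
    then show ?thesis using sublinear_minus[OF m(1), of b] by simp
  qed
  have sub: "m (x + y) \<le> m x + m y" for x y using m(1) by (simp add: sublinear_def)
  have add: "m (x + y) = m x + m y" for x y
    using sub[of x y] sub[of "x + y" "- y"] odd[of y] by simp
  have le: "m x \<le> p x" for x using m(2) tilt_sublinear(2)[OF p, of a] by (meson le_fun_def order_trans)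
  have "m (- a) \<le> - p a" using m(2) tilt_sublinear(3)[OF p, of a] by (meson le_fun_def order_trans)
  then have "m a = p a" using odd[of a] le[of a] by simp
  moreover have "m (s r x) = r * m x" for r x
  proof (cases "r \<ge> 0")
    case True then show ?thesis by (rule sublinear_scale[OF m(1)])
  next
    case False
    then have "m (s (- r) x) = - r * m x" by (intro sublinear_scale[OF m(1)]) simp
    then show ?thesis using odd[of "s r x"] by (simp add: scale_minus_left)
  qed
  ultimately show thesis using that[of m] add le by blast
qed

end

section \<open>Weights\<close>

lemma sum_fun_apply: "(\<Sum>i\<in>A. f i) x = (\<Sum>i\<in>A. f i x)"
  for f :: "'i \<Rightarrow> 'x \<Rightarrow> 'b::ab_group_add"
  by (induction A rule: infinite_finite_induct) auto

text \<open>
  Dominated weights are functionals below the unconditional norm that is generated by \<open>u\<close>, which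
  is the supremum over all multipliers \<open>\<epsilon>\<close>. One choice of \<open>\<epsilon>\<close> even serves all nonnegative \<open>b\<close>.
\<close>

definition dominated_weight :: "('k::real_normed_field, 'a::ab_group_add) nspace \<Rightarrow> (nat \<Rightarrow> 'a) \<Rightarrow> (nat \<Rightarrow> real) \<Rightarrow> bool" where
  "dominated_weight V u w \<longleftrightarrow> (\<forall>i. 0 \<le> w i) \<and>
     (\<exists>\<epsilon>. (\<forall>i. norm (\<epsilon> i) \<le> 1) \<and> (\<forall>A b. finite A \<longrightarrow> (\<forall>i. 0 \<le> b i) \<longrightarrow>
        (\<Sum>i\<in>A. w i * b i) \<le> nrm V (\<Sum>i\<in>A. scal V (\<epsilon> i * of_real (b i)) (u i))))"

lemma dominated_weight_le_nrm:
  assumes "normed_space V" "\<And>i. u i \<in> vecs V" "dominated_weight V u w"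
  shows "w i \<le> nrm V (u i)"
proof -
  interpret normed V by unfold_locales fact
  obtain \<epsilon> where \<epsilon>: "\<forall>i. norm (\<epsilon> i) \<le> 1" and le: "\<And>A b. finite A \<Longrightarrow> (\<forall>i. 0 \<le> b i) \<Longrightarrow>
      (\<Sum>i\<in>A. w i * b i) \<le> nrm V (\<Sum>i\<in>A. scal V (\<epsilon> i * of_real (b i)) (u i))"
    using assms(3) unfolding dominated_weight_def by blast
  have "w i \<le> norm (\<epsilon> i) * nrm V (u i)"
    using le[of "{i}" "\<lambda>_. 1"] assms(2) by simp
  also have "\<dots> \<le> 1 * nrm V (u i)" using \<epsilon> assms(2) by (intro mult_right_mono) auto
  finally show ?thesis by simp
qed

text \<open>
  Scalar sequences carry the seminorm \<open>p x = \<parallel>\<Sum>i\<in>F. x i * u i\<parallel>\<close>. A real linear functional \<open>g\<close> below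
  \<open>p\<close> that agrees with \<open>p\<close> at \<open>c\<close> gives the weight \<open>w i\<close>, the maximum of \<open>g\<close> over the scalars of
  modulus at most 1 in the \<open>i\<close>-th place; the scalar where the maximum is attained serves as \<open>\<epsilon> i\<close>.
\<close>

theorem norming_weight:
  fixes V :: "('k::{real_normed_field,euclidean_space}, 'a::ab_group_add) nspace"
  assumes "normed_space V" and u: "\<And>i. u i \<in> vecs V" and F: "finite F"
  obtains w where "dominated_weight V u w"
    "nrm V (\<Sum>i\<in>F. scal V (c i) (u i)) \<le> (\<Sum>i\<in>F. w i * norm (c i))"
proof -
  interpret normed V by unfold_locales fact
  define s :: "real \<Rightarrow> (nat \<Rightarrow> 'k) \<Rightarrow> nat \<Rightarrow> 'k" where "s r x = (\<lambda>i. of_real r * x i)" for r x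
  have vs: "vector_space s"
    by unfold_locales (auto simp: s_def fun_eq_iff algebra_simps)
  define p where "p x = nrm V (\<Sum>i\<in>F. scal V (x i) (u i))" for x :: "nat \<Rightarrow> 'k"
  have mem: "(\<Sum>i\<in>A. scal V (x i) (u i)) \<in> vecs V" for x A using u by (intro sum_mem) auto
  have p: "sublinear s p"
    unfolding sublinear_def[OF vs]
  proof (intro conjI allI impI)
    fix x y :: "nat \<Rightarrow> 'k"
    show "p (x + y) \<le> p x + p y"
      using nrm_add[OF mem mem, of x F y F] by (simp add: p_def scale_left_distrib sum.distrib)
  next
    fix r :: real and x :: "nat \<Rightarrow> 'k" assume r: "r > 0"
    have "(\<Sum>i\<in>F. scal V (s r x i) (u i)) = scal V (of_real r) (\<Sum>i\<in>F. scal V (x i) (u i))"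
      by (simp add: s_def scale_sum_right)
    then show "p (s r x) \<le> r * p x" using mem[of x F] r by (simp add: p_def)
  qed
  define d :: "nat \<Rightarrow> 'k \<Rightarrow> nat \<Rightarrow> 'k" where "d i \<beta> = (\<lambda>j. if j = i then \<beta> else 0)" for i \<beta>
  define a where "a = (\<Sum>i\<in>F. d i (c i))"
  have aF: "a i = c i" if "i \<in> F" for i
    using F that by (simp add: a_def sum_fun_apply d_def)
  obtain g where g: "\<And>x y. g (x + y) = g x + g y" "\<And>r x. g (s r x) = r * g x"
    "\<And>x. g x \<le> p x" "g a = p a"
    using hahn_banach[OF vs p] by blast
  have g0: "g 0 = 0" using g(1)[of 0 0] by simp
  have gsum: "g (\<Sum>i\<in>A. h i) = (\<Sum>i\<in>A. g (h i))" if "finite A" for A :: "nat set" and h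
    using that
  proof (induction A rule: finite_induct)
    case (insert i A)
    have "sum h (insert i A) = h i + sum h A" by (rule sum.insert) fact+
    then have "g (sum h (insert i A)) = g (h i) + (\<Sum>i\<in>A. g (h i))"
      by (simp only: g(1) insert.IH)
    also have "\<dots> = (\<Sum>i\<in>insert i A. g (h i))" using insert.hyps by simp
    finally show ?case .
  qed (simp only: sum.empty g0)
  have lin: "linear (\<lambda>\<beta>. g (d i \<beta>))" for i
  proof
    fix \<beta> \<gamma> :: 'k and r :: real
    have "d i (\<beta> + \<gamma>) = d i \<beta> + d i \<gamma>" by (auto simp: d_def)
    then show "g (d i (\<beta> + \<gamma>)) = g (d i \<beta>) + g (d i \<gamma>)" using g(1) by simp
    have "d i (r *\<^sub>R \<beta>) = s r (d i \<beta>)" by (auto simp: d_def s_def scaleR_conv_of_real)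
    then show "g (d i (r *\<^sub>R \<beta>)) = r *\<^sub>R g (d i \<beta>)" using g(2) by simp
  qed
  have scaled: "g (d i (of_real r * \<beta>)) = r * g (d i \<beta>)" for i r \<beta>
    using linear_cmul[OF lin, of i r \<beta>] by (simp add: scaleR_conv_of_real)
  have "\<exists>\<epsilon>. norm \<epsilon> \<le> 1 \<and> (\<forall>\<beta>. norm \<beta> \<le> 1 \<longrightarrow> g (d i \<beta>) \<le> g (d i \<epsilon>))" for i
  proof -
    have "continuous_on (cball 0 1) (\<lambda>\<beta>. g (d i \<beta>))"
      using lin linear_conv_bounded_linear linear_continuous_on by blast
    then have "\<exists>\<epsilon>\<in>cball 0 1. \<forall>\<beta>\<in>cball 0 1. g (d i \<beta>) \<le> g (d i \<epsilon>)"
      by (intro continuous_attains_sup) auto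
    then show ?thesis by auto
  qed
  then obtain \<epsilon> where \<epsilon>: "\<And>i. norm (\<epsilon> i) \<le> 1" "\<And>i \<beta>. norm \<beta> \<le> 1 \<Longrightarrow> g (d i \<beta>) \<le> g (d i (\<epsilon> i))"
    by metis
  define w where "w i = g (d i (\<epsilon> i))" for i
  have w_ge: "g (d i \<beta>) \<le> w i * norm \<beta>" for i \<beta>
  proof (cases "\<beta> = 0")
    case True then show ?thesis using scaled[of i 0 0] by simp
  next
    case False
    have "g (d i \<beta>) = norm \<beta> * g (d i (of_real (1 / norm \<beta>) * \<beta>))"
      unfolding scaled using False by simp
    also have "\<dots> \<le> norm \<beta> * w i"
      unfolding w_def using False by (intro mult_left_mono \<epsilon>(2)) (auto simp: norm_mult norm_divide)
    finally show ?thesis by (simp add: mult.commute)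
  qed
  have w0: "0 \<le> w i" for i
    using \<epsilon>(2)[of 0 i] scaled[of i 0 0] by (simp add: w_def)
  have "dominated_weight V u w"
    unfolding dominated_weight_def
  proof (intro conjI allI w0 exI[of _ "\<lambda>i. if i \<in> F then \<epsilon> i else 0"] impI)
    show "norm (if i \<in> F then \<epsilon> i else 0) \<le> 1" for i using \<epsilon>(1) by simp
    fix A :: "nat set" and b :: "nat \<Rightarrow> real" assume A: "finite A" and b: "\<forall>i. 0 \<le> b i"
    let ?x = "\<Sum>i\<in>A. d i (of_real (b i) * \<epsilon> i)"
    have x: "?x j = (if j \<in> A then of_real (b j) * \<epsilon> j else 0)" for j
      using A by (simp add: sum_fun_apply d_def)
    have "(\<Sum>i\<in>A. w i * b i) = g ?x"
      unfolding gsum[OF A] scaled w_def by (simp add: mult.commute)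
    also have "\<dots> \<le> p ?x" by (rule g(3))
    also have "(\<Sum>i\<in>F. scal V (?x i) (u i)) = (\<Sum>i\<in>F \<inter> A. scal V (of_real (b i) * \<epsilon> i) (u i))"
      using F unfolding x by (subst sum.inter_restrict) (auto intro!: sum.cong)
    then have "p ?x = nrm V (\<Sum>i\<in>F \<inter> A. scal V (of_real (b i) * \<epsilon> i) (u i))" by (simp add: p_def)
    also have "(\<Sum>i\<in>F \<inter> A. scal V (of_real (b i) * \<epsilon> i) (u i)) =
        (\<Sum>i\<in>A. scal V ((if i \<in> F then \<epsilon> i else 0) * of_real (b i)) (u i))"
      using A by (subst Int_commute, subst sum.inter_restrict) (auto intro!: sum.cong simp: mult.commute)
    finally show "(\<Sum>i\<in>A. w i * b i) \<le>
        nrm V (\<Sum>i\<in>A. scal V ((if i \<in> F then \<epsilon> i else 0) * of_real (b i)) (u i))" .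
  qed
  moreover have "nrm V (\<Sum>i\<in>F. scal V (c i) (u i)) \<le> (\<Sum>i\<in>F. w i * norm (c i))"
  proof -
    have "nrm V (\<Sum>i\<in>F. scal V (c i) (u i)) = g a" using g(4) aF by (simp add: p_def)
    also have "\<dots> = (\<Sum>i\<in>F. g (d i (c i)))" unfolding a_def gsum[OF F] ..
    finally show ?thesis using w_ge by (simp add: sum_mono)
  qed
  ultimately show thesis using that by blast
qed

section \<open>Weighted sequence spaces\<close>

text \<open>
  The norm of the sequence space is a supremum, which is meaningful only for bounded sequences;
  upper bounds for it make sense for all sequences.
\<close>

definition wbound :: "(nat \<Rightarrow> real) set \<Rightarrow> (nat \<Rightarrow> 'k::real_normed_field) \<Rightarrow> real \<Rightarrow> bool" where
  "wbound \<Phi> a c \<longleftrightarrow> (\<forall>\<phi>\<in>\<Phi>. \<forall>n. (\<Sum>i<n. \<phi> i * norm (a i)) \<le> c)"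

definition tail :: "nat \<Rightarrow> (nat \<Rightarrow> 'k::real_normed_field) \<Rightarrow> nat \<Rightarrow> 'k" where
  "tail N a = (\<lambda>i. if i < N then 0 else a i)"

text \<open>
  The vectors are the limits of finitely supported sequences: a sequence is such a limit if and
  only if its tails become small uniformly over all weights.
\<close>

definition wspace :: "(nat \<Rightarrow> real) set \<Rightarrow> ('k::real_normed_field, nat \<Rightarrow> 'k) nspace" where
  "wspace \<Phi> = \<lparr>scal = (\<lambda>c a i. c * a i), vecs = {a. \<forall>e>0. \<exists>N. wbound \<Phi> (tail N a) e},
     nrm = (\<lambda>a. SUP (\<phi>, n)\<in>\<Phi> \<times> UNIV. \<Sum>i<n. \<phi> i * norm (a i))\<rparr>"

definition unit_seq :: "nat \<Rightarrow> nat \<Rightarrow> 'k::real_normed_field" where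
  "unit_seq n = (\<lambda>i. if i = n then 1 else 0)"

lemma scal_wspace [simp]: "scal (wspace \<Phi>) c a = (\<lambda>i. c * a i)"
  by (simp add: wspace_def)

text \<open>
  The coordinate weights ensure that the norm dominates each coordinate; they also make the
  coordinates nondegenerate to which no other weight gives a positive value.
\<close>

locale weights =
  fixes \<Phi> :: "(nat \<Rightarrow> real) set"
  assumes weight_nonneg: "\<phi> \<in> \<Phi> \<Longrightarrow> 0 \<le> \<phi> i"
    and weight_le_1: "\<phi> \<in> \<Phi> \<Longrightarrow> \<phi> i \<le> 1"
    and coordinate_weight: "(\<lambda>j. if j = i then 1 else 0) \<in> \<Phi>"
begin

lemma wbound_dominated:
  assumes "wbound \<Phi> a c" "\<And>i. norm (b i) \<le> norm (a i)"
  shows "wbound \<Phi> b c"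
  unfolding wbound_def
proof (intro ballI allI)
  fix \<phi> n assume \<phi>: "\<phi> \<in> \<Phi>"
  have "(\<Sum>i<n. \<phi> i * norm (b i)) \<le> (\<Sum>i<n. \<phi> i * norm (a i))"
    using assms(2) weight_nonneg[OF \<phi>] by (intro sum_mono mult_left_mono) auto
  then show "(\<Sum>i<n. \<phi> i * norm (b i)) \<le> c"
    using assms(1) \<phi> unfolding wbound_def by (meson order_trans)
qed

lemma wbound_mono: "wbound \<Phi> a c \<Longrightarrow> c \<le> d \<Longrightarrow> wbound \<Phi> a d"
  unfolding wbound_def by (meson order_trans)

lemma wbound_add:
  assumes "wbound \<Phi> a c" "wbound \<Phi> b d"
  shows "wbound \<Phi> (\<lambda>i. a i + b i) (c + d)"
  unfolding wbound_def
proof (intro ballI allI)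
  fix \<phi> n assume \<phi>: "\<phi> \<in> \<Phi>"
  have "(\<Sum>i<n. \<phi> i * norm (a i + b i)) \<le> (\<Sum>i<n. \<phi> i * norm (a i) + \<phi> i * norm (b i))"
    unfolding distrib_left[symmetric]
    using weight_nonneg[OF \<phi>] by (intro sum_mono mult_left_mono norm_triangle_ineq)
  also have "\<dots> \<le> c + d"
    using assms \<phi> unfolding wbound_def by (simp add: sum.distrib add_mono)
  finally show "(\<Sum>i<n. \<phi> i * norm (a i + b i)) \<le> c + d" .
qed

lemma wbound_scale:
  assumes "wbound \<Phi> a c"
  shows "wbound \<Phi> (\<lambda>i. k * a i) (norm k * c)"
  unfolding wbound_def
proof (intro ballI allI)
  fix \<phi> n assume \<phi>: "\<phi> \<in> \<Phi>"
  have "(\<Sum>i<n. \<phi> i * norm (k * a i)) = norm k * (\<Sum>i<n. \<phi> i * norm (a i))"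
    by (simp add: norm_mult sum_distrib_left mult_ac)
  also have "\<dots> \<le> norm k * c"
    using assms \<phi> unfolding wbound_def by (intro mult_left_mono) auto
  finally show "(\<Sum>i<n. \<phi> i * norm (k * a i)) \<le> norm k * c" .
qed

lemma wbound_zero: "wbound \<Phi> (\<lambda>i. 0) 0"
  by (simp add: wbound_def)

lemma wbound_finite_support:
  assumes "\<And>i. i \<ge> N \<Longrightarrow> a i = 0"
  shows "wbound \<Phi> a (\<Sum>i<N. norm (a i))"
  unfolding wbound_def
proof (intro ballI allI)
  fix \<phi> n assume \<phi>: "\<phi> \<in> \<Phi>"
  have "(\<Sum>i<n. \<phi> i * norm (a i)) \<le> (\<Sum>i<n. norm (a i))"
    using weight_le_1[OF \<phi>] by (intro sum_mono) (simp add: mult_left_le_one_le weight_nonneg[OF \<phi>])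
  also have "\<dots> \<le> (\<Sum>i<max n N. norm (a i))" by (intro sum_mono2) auto
  also have "\<dots> = (\<Sum>i<N. norm (a i))"
    using assms by (intro sum.mono_neutral_right) auto
  finally show "(\<Sum>i<n. \<phi> i * norm (a i)) \<le> (\<Sum>i<N. norm (a i))" .
qed

lemma wbound_coordinate:
  assumes "wbound \<Phi> a c"
  shows "norm (a i) \<le> c"
proof -
  have "(\<Sum>j<Suc i. (if j = i then 1 else 0) * norm (a j)) \<le> c"
    using bspec[OF assms[unfolded wbound_def] coordinate_weight[of i]] by (rule spec)
  moreover have "(\<Sum>j<Suc i. (if j = i then 1 else 0) * norm (a j)) = norm (a i)"
    by (simp add: if_distrib[of "\<lambda>t. t * _"] cong: if_cong)
  ultimately show ?thesis by simp
qed

lemma wbound_limit: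
  assumes lim: "\<And>i. (\<lambda>m. s m i) \<longlonglongrightarrow> a i" and le: "\<And>m. m \<ge> N \<Longrightarrow> wbound \<Phi> (s m) c"
  shows "wbound \<Phi> a c"
  unfolding wbound_def
proof (intro ballI allI)
  fix \<phi> n assume \<phi>: "\<phi> \<in> \<Phi>"
  have "(\<lambda>m. \<Sum>i<n. \<phi> i * norm (s m i)) \<longlonglongrightarrow> (\<Sum>i<n. \<phi> i * norm (a i))"
    by (intro tendsto_sum tendsto_mult tendsto_const tendsto_norm lim)
  then show "(\<Sum>i<n. \<phi> i * norm (a i)) \<le> c"
    using le \<phi> unfolding wbound_def by (intro LIMSEQ_le_const2) blast+
qed

lemma vecs_wspace_iff: "a \<in> vecs (wspace \<Phi>) \<longleftrightarrow> (\<forall>e>0. \<exists>N. wbound \<Phi> (tail N a) e)"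
  by (simp add: wspace_def)

lemma vecs_bounded:
  assumes "a \<in> vecs (wspace \<Phi>)"
  obtains c where "wbound \<Phi> a c"
proof -
  obtain N where N: "wbound \<Phi> (tail N a) 1" using assms zero_less_one unfolding vecs_wspace_iff by blast
  have "wbound \<Phi> (\<lambda>i. if i < N then a i else 0) (\<Sum>i<N. norm (if i < N then a i else 0))"
    by (rule wbound_finite_support) simp
  from wbound_add[OF this N] have "wbound \<Phi> a ((\<Sum>i<N. norm (if i < N then a i else 0)) + 1)"
    by (rule wbound_dominated) (simp add: tail_def)
  then show thesis by (rule that)
qed

lemma nrm_wspace_least: "wbound \<Phi> a c \<Longrightarrow> nrm (wspace \<Phi>) a \<le> c"
  unfolding wspace_def wbound_def using coordinate_weight
  by (auto intro!: cSUP_least)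

lemma wbound_nrm:
  assumes "a \<in> vecs (wspace \<Phi>)"
  shows "wbound \<Phi> a (nrm (wspace \<Phi>) a)"
proof -
  obtain c where c: "wbound \<Phi> a c" by (rule vecs_bounded[OF assms])
  have bdd: "bdd_above ((\<lambda>(\<phi>, n). \<Sum>i<n. \<phi> i * norm (a i)) ` (\<Phi> \<times> UNIV))"
    using c unfolding wbound_def by (intro bdd_aboveI2[of _ _ c]) auto
  show ?thesis
    unfolding wbound_def
  proof (intro ballI allI)
    fix \<phi> n assume "\<phi> \<in> \<Phi>"
    then show "(\<Sum>i<n. \<phi> i * norm (a i)) \<le> nrm (wspace \<Phi>) a"
      using cSUP_upper[OF _ bdd, of "(\<phi>, n)"] by (simp add: wspace_def)
  qed
qed

lemma nrm_wspace_le_iff: "a \<in> vecs (wspace \<Phi>) \<Longrightarrow> nrm (wspace \<Phi>) a \<le> c \<longleftrightarrow> wbound \<Phi> a c"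
  using nrm_wspace_least wbound_nrm wbound_mono by blast

lemma coordinate_le_nrm: "a \<in> vecs (wspace \<Phi>) \<Longrightarrow> norm (a i) \<le> nrm (wspace \<Phi>) a"
  using wbound_coordinate wbound_nrm by blast

lemma vecs_wspace_dominated:
  assumes "a \<in> vecs (wspace \<Phi>)" "\<And>i. norm (b i) \<le> norm (a i)"
  shows "b \<in> vecs (wspace \<Phi>)"
  unfolding vecs_wspace_iff
proof (intro allI impI)
  fix e :: real assume "e > 0"
  then obtain N where "wbound \<Phi> (tail N a) e" using assms(1) unfolding vecs_wspace_iff by blast
  then have "wbound \<Phi> (tail N b) e"
    by (rule wbound_dominated) (simp add: tail_def assms(2))
  then show "\<exists>N. wbound \<Phi> (tail N b) e" by blast
qed

lemma finite_support_mem: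
  assumes "\<And>i. i \<ge> N \<Longrightarrow> a i = 0"
  shows "a \<in> vecs (wspace \<Phi>)"
  unfolding vecs_wspace_iff
proof (intro allI impI exI)
  have "tail N a = (\<lambda>i. 0)" using assms by (auto simp: tail_def)
  then show "wbound \<Phi> (tail N a) e" if "e > 0" for e
    using wbound_mono[OF wbound_zero, of e] that by simp
qed

lemma unit_seq_mem: "unit_seq n \<in> vecs (wspace \<Phi>)"
  by (rule finite_support_mem[of "Suc n"]) (simp add: unit_seq_def)

lemma vecs_add:
  assumes "a \<in> vecs (wspace \<Phi>)" "b \<in> vecs (wspace \<Phi>)"
  shows "(\<lambda>i. a i + b i) \<in> vecs (wspace \<Phi>)"
  unfolding vecs_wspace_iff
proof (intro allI impI)
  fix e :: real assume "e > 0"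
  then obtain M N where M: "wbound \<Phi> (tail M a) (e / 2)" and N: "wbound \<Phi> (tail N b) (e / 2)"
    using assms unfolding vecs_wspace_iff by (meson half_gt_zero)
  have "wbound \<Phi> (tail (max M N) a) (e / 2)" "wbound \<Phi> (tail (max M N) b) (e / 2)"
    by (rule wbound_dominated[OF M]; simp add: tail_def; linarith)
       (rule wbound_dominated[OF N]; simp add: tail_def; linarith)
  from wbound_add[OF this] have "wbound \<Phi> (tail (max M N) (\<lambda>i. a i + b i)) e"
    by (rule wbound_dominated[OF wbound_mono]) (auto simp: tail_def)
  then show "\<exists>N. wbound \<Phi> (tail N (\<lambda>i. a i + b i)) e" by blast
qed

lemma vecs_scale:
  assumes "a \<in> vecs (wspace \<Phi>)"
  shows "(\<lambda>i. c * a i) \<in> vecs (wspace \<Phi>)"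
  unfolding vecs_wspace_iff
proof (intro allI impI)
  fix e :: real assume "e > 0"
  then obtain N where N: "wbound \<Phi> (tail N a) (e / (norm c + 1))"
    using assms unfolding vecs_wspace_iff
    by (meson add_nonneg_pos divide_pos_pos norm_ge_zero zero_less_one)
  have "wbound \<Phi> (\<lambda>i. c * tail N a i) (norm c * (e / (norm c + 1)))"
    by (rule wbound_scale[OF N])
  moreover have "norm c * (e / (norm c + 1)) \<le> e"
    using \<open>e > 0\<close> by (simp add: divide_le_eq add_pos_nonneg algebra_simps not_less)
  ultimately have "wbound \<Phi> (tail N (\<lambda>i. c * a i)) e"
    by (rule wbound_dominated[OF wbound_mono]) (simp add: tail_def)
  then show "\<exists>N. wbound \<Phi> (tail N (\<lambda>i. c * a i)) e" by blast
qed

lemma normed_space_wspace: "normed_space (wspace \<Phi> :: ('k::real_normed_field, nat \<Rightarrow> 'k) nspace)"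
proof -
  let ?B = "wspace \<Phi> :: ('k, nat \<Rightarrow> 'k) nspace"
  have vs: "vector_space (scal ?B)"
    by unfold_locales (auto simp: fun_eq_iff algebra_simps)
  then interpret vector_space "scal ?B" .
  have zero: "0 \<in> vecs ?B" by (rule finite_support_mem[of 0]) simp
  have "subspace (vecs ?B)"
  proof (rule subspaceI[OF zero])
    show "a + b \<in> vecs ?B" if "a \<in> vecs ?B" "b \<in> vecs ?B" for a b
      using vecs_add[OF that] by (simp add: plus_fun_def)
    show "scal ?B c a \<in> vecs ?B" if "a \<in> vecs ?B" for c a
      using vecs_scale[OF that] by simp
  qed
  moreover have "0 \<le> nrm ?B a \<and> (nrm ?B a = 0 \<longleftrightarrow> a = 0)" if a: "a \<in> vecs ?B" for a
  proof (intro conjI iffI)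
    show "0 \<le> nrm ?B a" using coordinate_le_nrm[OF a, of 0] norm_ge_zero order_trans by blast
    show "a = 0" if "nrm ?B a = 0" using coordinate_le_nrm[OF a] that by (auto simp: fun_eq_iff)
    show "nrm ?B a = 0" if "a = 0"
    proof (rule antisym)
      have "nrm ?B (\<lambda>i. 0) \<le> 0" by (rule nrm_wspace_least[OF wbound_zero])
      then show "nrm ?B a \<le> 0" using that by (simp add: zero_fun_def)
    qed fact
  qed
  moreover have scale_le: "nrm ?B (scal ?B c a) \<le> norm c * nrm ?B a" if a: "a \<in> vecs ?B" for c a
    using nrm_wspace_least[OF wbound_scale[OF wbound_nrm[OF a]]] by simp
  have "nrm ?B (scal ?B c a) = norm c * nrm ?B a" if a: "a \<in> vecs ?B" for c a
  proof (cases "c = 0")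
    case True
    then have "scal ?B c a = (\<lambda>i. 0)" by simp
    moreover have "nrm ?B (\<lambda>i. 0) \<le> 0" by (rule nrm_wspace_least[OF wbound_zero])
    moreover have "0 \<le> nrm ?B (\<lambda>i. 0)"
      using coordinate_le_nrm[OF zero, of 0] by (simp add: zero_fun_def)
    ultimately show ?thesis using True by simp
  next
    case False
    have sa: "scal ?B c a \<in> vecs ?B" using vecs_scale[OF a] by simp
    have "scal ?B (inverse c) (scal ?B c a) = a" using False by (simp flip: mult.assoc)
    then have "nrm ?B a \<le> norm (inverse c) * nrm ?B (scal ?B c a)" using scale_le[OF sa, of "inverse c"] by simp
    then have "norm c * nrm ?B a \<le> nrm ?B (scal ?B c a)" using False by (simp add: norm_inverse norm_divide field_simps)
    then show ?thesis using scale_le[OF a, of c] by linarith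
  qed
  moreover have "nrm ?B (a + b) \<le> nrm ?B a + nrm ?B b" if "a \<in> vecs ?B" "b \<in> vecs ?B" for a b
    using nrm_wspace_least[OF wbound_add[OF wbound_nrm[OF that(1)] wbound_nrm[OF that(2)]]]
    by (simp add: plus_fun_def)
  ultimately show ?thesis using vs unfolding normed_space_def by blast
qed

lemma banach_space_wspace:
  "banach_space (wspace \<Phi> :: ('k::{real_normed_field,euclidean_space}, nat \<Rightarrow> 'k) nspace)"
proof -
  let ?B = "wspace \<Phi> :: ('k, nat \<Rightarrow> 'k) nspace"
  interpret normed ?B by unfold_locales (rule normed_space_wspace)
  have "\<exists>x. converges_in ?B s x" if s: "range s \<subseteq> vecs ?B" and cauchy: "cauchy_in ?B s" for s
  proof -
    have sm: "s m \<in> vecs ?B" for m using s by auto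
    have C: "\<exists>N. \<forall>m\<ge>N. \<forall>n\<ge>N. wbound \<Phi> (s m - s n) e" if "e > 0" for e
      using cauchy that nrm_wspace_le_iff[OF diff_mem[OF sm sm]] unfolding cauchy_in_def
      by (meson less_imp_le)
    have "Cauchy (\<lambda>m. s m i)" for i
    proof (rule metric_CauchyI)
      fix e :: real assume "e > 0"
      then obtain N where "\<forall>m\<ge>N. \<forall>n\<ge>N. wbound \<Phi> (s m - s n) (e / 2)" using C[of "e/2"] by auto
      then have "\<forall>m\<ge>N. \<forall>n\<ge>N. norm (s m i - s n i) \<le> e / 2"
        using wbound_coordinate[where i = i] by fastforce
      then show "\<exists>N. \<forall>m\<ge>N. \<forall>n\<ge>N. dist (s m i) (s n i) < e"
        using \<open>e > 0\<close> by (intro exI[of _ N]) (force simp: dist_norm)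
    qed
    then have "\<forall>i. \<exists>l. (\<lambda>m. s m i) \<longlonglongrightarrow> l" using Cauchy_convergent unfolding convergent_def by blast
    then obtain a where a: "\<And>i. (\<lambda>m. s m i) \<longlonglongrightarrow> a i" by metis
    have close: "\<exists>N. \<forall>m\<ge>N. wbound \<Phi> (s m - a) e" if e: "e > 0" for e
    proof -
      obtain N where N: "\<forall>m\<ge>N. \<forall>n\<ge>N. wbound \<Phi> (s m - s n) e" using C[OF e] by blast
      have "wbound \<Phi> (s m - a) e" if "m \<ge> N" for m
      proof (rule wbound_limit)
        show "(\<lambda>n. (s m - s n) i) \<longlonglongrightarrow> (s m - a) i" for i
          by (simp add: a tendsto_diff)
        show "wbound \<Phi> (s m - s n) e" if "n \<ge> N" for n using N \<open>m \<ge> N\<close> that by blast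
      qed
      then show ?thesis by blast
    qed
    have aV: "a \<in> vecs ?B"
      unfolding vecs_wspace_iff
    proof (intro allI impI)
      fix e :: real assume "e > 0"
      then obtain m where m: "wbound \<Phi> (s m - a) (e / 2)" using close[of "e/2"] by auto
      obtain N where N: "wbound \<Phi> (tail N (s m)) (e / 2)"
        using sm[of m] \<open>e > 0\<close> unfolding vecs_wspace_iff by (meson half_gt_zero)
      have "wbound \<Phi> (\<lambda>i. - tail N (s m - a) i) (e / 2)"
        by (rule wbound_dominated[OF m]) (simp add: tail_def)
      from wbound_add[OF N this] have "wbound \<Phi> (tail N a) e"
        by (rule wbound_dominated[OF wbound_mono]) (auto simp: tail_def)
      then show "\<exists>N. wbound \<Phi> (tail N a) e" by blast
    qed
    have "converges_in ?B s a"
    proof (rule converges_inI[OF aV s])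
      fix e :: real assume "e > 0"
      then show "\<exists>N. \<forall>n\<ge>N. nrm ?B (s n - a) \<le> e" using close nrm_wspace_least by meson
    qed
    then show ?thesis by blast
  qed
  then show ?thesis unfolding banach_space_def using normed_space_wspace by blast
qed

lemma tail_nrm_small:
  assumes "a \<in> vecs (wspace \<Phi>)" "e > 0"
  obtains N where "\<And>b. (\<And>i. norm (b i) \<le> norm (a i)) \<Longrightarrow> (\<And>i. i < N \<Longrightarrow> b i = 0) \<Longrightarrow>
    nrm (wspace \<Phi> :: ('k::real_normed_field, nat \<Rightarrow> 'k) nspace) b \<le> e"
proof -
  obtain N where N: "wbound \<Phi> (tail N a) e" using assms unfolding vecs_wspace_iff by blast
  show thesis
  proof (rule that[of N])
    fix b :: "nat \<Rightarrow> 'k" assume "\<And>i. norm (b i) \<le> norm (a i)" "\<And>i. i < N \<Longrightarrow> b i = 0"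
    then have "wbound \<Phi> b e"
      by (intro wbound_dominated[OF N]) (auto simp: tail_def)
    then show "nrm (wspace \<Phi>) b \<le> e" by (rule nrm_wspace_least)
  qed
qed

lemma separable_wspace:
  "separable_in_norm (wspace \<Phi> :: ('k::{real_normed_field,euclidean_space}, nat \<Rightarrow> 'k) nspace)"
proof -
  let ?B = "wspace \<Phi> :: ('k, nat \<Rightarrow> 'k) nspace"
  interpret normed ?B by unfold_locales (rule normed_space_wspace)
  obtain Q :: "'k set" where Q: "countable Q" "\<And>U. open U \<Longrightarrow> U \<noteq> {} \<Longrightarrow> \<exists>d\<in>Q. d \<in> U"
    using countable_dense_setE by blast
  define seq :: "'k list \<Rightarrow> nat \<Rightarrow> 'k" where "seq l = (\<lambda>i. if i < length l then l ! i else 0)" for l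
  have seqV: "seq l \<in> vecs ?B" for l by (rule finite_support_mem[of "length l"]) (simp add: seq_def)
  have "\<exists>d\<in>seq ` lists Q. nrm ?B (a - d) < e" if a: "a \<in> vecs ?B" and "e > 0" for a e
  proof -
    obtain N where N: "\<And>b. (\<And>i. norm (b i) \<le> norm (a i)) \<Longrightarrow> (\<And>i. i < N \<Longrightarrow> b i = 0) \<Longrightarrow>
        nrm ?B b \<le> e / 3"
      using tail_nrm_small[OF a, of "e / 3"] \<open>e > 0\<close> by auto
    define r where "r = e / (3 * (real N + 1))"
    have r: "r > 0" using \<open>e > 0\<close> by (simp add: r_def)
    have "\<exists>d\<in>Q. norm (a i - d) < r" for i
      using Q(2)[of "ball (a i) r"] r by (auto simp: dist_norm)
    then obtain d where d: "\<And>i. d i \<in> Q" "\<And>i. norm (a i - d i) < r" by metis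
    let ?l = "map d [0..<N]"
    let ?h = "\<lambda>i. if i < N then a i - d i else 0"
    have hV: "?h \<in> vecs ?B" by (rule finite_support_mem[of N]) simp
    have tV: "tail N a \<in> vecs ?B" by (rule vecs_wspace_dominated[OF a]) (simp add: tail_def)
    have "nrm ?B ?h \<le> (\<Sum>i<N. norm (?h i))"
      by (intro nrm_wspace_least wbound_finite_support) simp
    also have "\<dots> \<le> (\<Sum>i<N. r)" using d(2) by (intro sum_mono) (auto intro: less_imp_le)
    also have "\<dots> \<le> e / 3" using \<open>e > 0\<close> by (simp add: r_def field_simps)
    finally have "nrm ?B ?h \<le> e / 3" .
    moreover have "nrm ?B (tail N a) \<le> e / 3" by (rule N) (auto simp: tail_def)
    moreover have "a - seq ?l = ?h + tail N a" by (auto simp: seq_def tail_def fun_eq_iff)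
    ultimately have "nrm ?B (a - seq ?l) < e"
      using nrm_add[OF hV tV] \<open>e > 0\<close> by simp
    moreover have "?l \<in> lists Q" using d(1) by auto
    ultimately show ?thesis by blast
  qed
  moreover have "countable (seq ` lists Q)" using Q(1) by auto
  ultimately show ?thesis
    unfolding separable_in_norm_def using seqV by (intro exI[of _ "seq ` lists Q"]) blast
qed

lemma sum_unit_seq: "(\<Sum>i\<in>A. scal (wspace \<Phi>) (a i) (unit_seq i)) = (\<lambda>j. if j \<in> A then a j else 0)"
  if "finite A" for a :: "nat \<Rightarrow> 'k::real_normed_field"
  using that by (auto simp: fun_eq_iff sum_fun_apply unit_seq_def if_distrib[of "(*) _"] cong: if_cong)

text \<open>
  Uniqueness of the expansion holds since coordinates are continuous. Any rearrangement
  converges since a partial sum that covers the first \<open>N\<close> coordinates differs from \<open>a\<close> by a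
  sequence dominated by a tail of \<open>a\<close>.
\<close>

lemma unconditional_basis_wspace:
  "unconditional_schauder_basis (wspace \<Phi> :: ('k::real_normed_field, nat \<Rightarrow> 'k) nspace) unit_seq"
proof -
  let ?B = "wspace \<Phi> :: ('k, nat \<Rightarrow> 'k) nspace"
  interpret normed ?B by unfold_locales (rule normed_space_wspace)
  let ?t = "\<lambda>\<alpha> n. scal ?B (\<alpha> n) (unit_seq n)"
  have t_mem: "?t \<alpha> n \<in> vecs ?B" for \<alpha> n using unit_seq_mem by blast
  have coeff: "\<alpha> = a" if "sums_in ?B (?t \<alpha>) a" for \<alpha> a
  proof
    fix i
    have aV: "a \<in> vecs ?B" using that sums_in_mem by blast
    have "norm (\<alpha> i - a i) \<le> 0"
    proof (rule LIMSEQ_le_const)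
      show "(\<lambda>n. nrm ?B ((\<Sum>i<n. ?t \<alpha> i) - a)) \<longlonglongrightarrow> 0"
        using that by (simp add: sums_in_def converges_in_def)
      have "norm (\<alpha> i - a i) \<le> nrm ?B ((\<Sum>i<n. ?t \<alpha> i) - a)" if "n > i" for n
      proof -
        have "(\<Sum>i<n. ?t \<alpha> i) - a \<in> vecs ?B" using t_mem aV by (intro diff_mem sum_mem)
        from coordinate_le_nrm[OF this, of i] show ?thesis
          using that by (simp add: sum_unit_seq del: scal_wspace)
      qed
      then show "\<exists>N. \<forall>n\<ge>N. norm (\<alpha> i - a i) \<le> nrm ?B ((\<Sum>i<n. ?t \<alpha> i) - a)"
        by (intro exI[of _ "Suc i"]) auto
    qed
    then show "\<alpha> i = a i" by simp
  qed
  have uncond: "unconditionally_sums_in ?B (?t a) a" if a: "a \<in> vecs ?B" for a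
    unfolding unconditionally_sums_in_def sums_in_def
  proof (intro allI impI)
    fix \<pi> :: "nat \<Rightarrow> nat" assume \<pi>: "bij \<pi>"
    have sum: "(\<Sum>i<n. (?t a \<circ> \<pi>) i) = (\<lambda>j. if j \<in> \<pi> ` {..<n} then a j else 0)" for n
    proof -
      have "(\<Sum>i<n. (?t a \<circ> \<pi>) i) = (\<Sum>i\<in>\<pi> ` {..<n}. ?t a i)"
        using \<pi> by (subst sum.reindex) (auto intro: inj_on_subset bij_is_inj)
      then show ?thesis by (simp add: sum_unit_seq del: scal_wspace)
    qed
    show "converges_in ?B (\<lambda>n. \<Sum>i<n. (?t a \<circ> \<pi>) i) a"
    proof (rule converges_inI[OF a])
      show "range (\<lambda>n. \<Sum>i<n. (?t a \<circ> \<pi>) i) \<subseteq> vecs ?B"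
        using t_mem by (auto intro!: sum_mem simp del: scal_wspace)
      fix e :: real assume "e > 0"
      then obtain N where N: "\<And>b. (\<And>i. norm (b i) \<le> norm (a i)) \<Longrightarrow> (\<And>i. i < N \<Longrightarrow> b i = 0) \<Longrightarrow>
          nrm ?B b \<le> e"
        using tail_nrm_small[OF a] by blast
      let ?M = "Suc (Max (insert 0 (inv \<pi> ` {..<N})))"
      have "nrm ?B ((\<Sum>i<n. (?t a \<circ> \<pi>) i) - a) \<le> e" if n: "n \<ge> ?M" for n
      proof (rule N)
        show "norm (((\<Sum>i<n. (?t a \<circ> \<pi>) i) - a) i) \<le> norm (a i)" for i
          unfolding sum by simp
        fix i assume "i < N"
        then have "inv \<pi> i \<le> Max (insert 0 (inv \<pi> ` {..<N}))" by (intro Max_ge) auto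
        then have "inv \<pi> i < n" using n by simp
        then have "i \<in> \<pi> ` {..<n}" using \<pi> by (metis bij_inv_eq_iff imageI lessThan_iff)
        then show "((\<Sum>i<n. (?t a \<circ> \<pi>) i) - a) i = 0" unfolding sum by simp
      qed
      then show "\<exists>N. \<forall>n\<ge>N. nrm ?B ((\<Sum>i<n. (?t a \<circ> \<pi>) i) - a) \<le> e" by blast
    qed
  qed
  show ?thesis
    unfolding unconditional_schauder_basis_def schauder_basis_def
  proof (intro conjI ballI allI impI)
    show "range unit_seq \<subseteq> vecs ?B" using unit_seq_mem by blast
    fix a assume a: "a \<in> vecs ?B"
    show "\<exists>!\<alpha>. sums_in ?B (?t \<alpha>) a"
      using unconditionally_sums_imp_sums[OF uncond[OF a]] coeff by (rule ex1I)
    fix \<alpha> assume "sums_in ?B (?t \<alpha>) a"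
    then have "\<alpha> = a" by (rule coeff)
    then show "unconditionally_sums_in ?B (?t \<alpha>) a" using uncond[OF a] by simp
  qed
qed

lemma separable_with_unconditional_basis_wspace:
  "separable_with_unconditional_basis
     (wspace \<Phi> :: ('k::{real_normed_field,euclidean_space}, nat \<Rightarrow> 'k) nspace)"
  unfolding separable_with_unconditional_basis_def
  using banach_space_wspace separable_wspace unconditional_basis_wspace by blast

end

section \<open>The universal weights\<close>

text \<open>
  The sequence \<open>v\<close> of numerators represents the weight with values \<open>v k / 2 ^ k\<close> in the unit
  interval.
\<close>

definition dyadic :: "(nat \<Rightarrow> nat) \<Rightarrow> bool" where
  "dyadic v \<longleftrightarrow> (\<forall>k. v k \<le> 2 ^ k)"

definition level_set :: "(nat \<Rightarrow> nat) set \<Rightarrow> nat \<Rightarrow> nat list set" where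
  "level_set W k = (\<lambda>v. map v [0..<Suc k]) ` W"

text \<open>
  The set \<open>level_set W k\<close> as a coordinate of the sequence space. The level is part of the code,
  which makes the branch \<open>node W\<close> injective and lets it tend to infinity.
\<close>

definition node :: "(nat \<Rightarrow> nat) set \<Rightarrow> nat \<Rightarrow> nat" where
  "node W k = prod_encode (k, to_nat_on (Collect finite) (level_set W k))"

definition level :: "nat \<Rightarrow> nat" where
  "level i = fst (prod_decode i)"

text \<open>
  The member \<open>v\<close> of \<open>W\<close> as a weight along the branch of \<open>W\<close>, extended by zero.
\<close>

definition node_weight :: "(nat \<Rightarrow> nat) set \<Rightarrow> (nat \<Rightarrow> nat) \<Rightarrow> nat \<Rightarrow> real" where
  "node_weight W v i = (if i = node W (level i) then v (level i) / 2 ^ level i else 0)"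

definition universal_weights :: "(nat \<Rightarrow> real) set" where
  "universal_weights = {node_weight W v | W v. W \<subseteq> Collect dyadic \<and> v \<in> W}
     \<union> range (\<lambda>i j. if j = i then 1 else 0)"

lemma level_node [simp]: "level (node W k) = k"
  by (simp add: level_def node_def)

lemma inj_node: "inj (node W)"
  by (metis injI level_node)

lemma le_node: "k \<le> node W k"
  by (simp add: node_def le_prod_encode_1)

lemma finite_level_set:
  assumes "W \<subseteq> Collect dyadic"
  shows "finite (level_set W k)"
proof (rule finite_subset)
  show "level_set W k \<subseteq> {l. set l \<subseteq> {..2 ^ k} \<and> length l = Suc k}"
  proof
    fix l assume "l \<in> level_set W k"
    then obtain v where v: "v \<in> W" "l = map v [0..<Suc k]" by (auto simp: level_set_def)
    have "v j \<le> 2 ^ k" if "j < Suc k" for j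
    proof -
      have "v j \<le> 2 ^ j" using v(1) assms by (auto simp: dyadic_def)
      also have "\<dots> \<le> (2::nat) ^ k" using that by (intro power_increasing) auto
      finally show ?thesis .
    qed
    then show "l \<in> {l. set l \<subseteq> {..2 ^ k} \<and> length l = Suc k}" using v(2) by auto
  qed
  show "finite {l :: nat list. set l \<subseteq> {..2 ^ k} \<and> length l = Suc k}"
    by (rule finite_lists_length_eq) simp
qed

text \<open>
  Branches that meet at a level share the initial segments up to that level. This needs finite
  level sets, as only finite sets are coded injectively.
\<close>

lemma level_set_eq_of_node_eq:
  assumes "W \<subseteq> Collect dyadic" "W' \<subseteq> Collect dyadic" "node W k = node W' k"
  shows "level_set W k = level_set W' k"
proof -
  have "countable (Collect finite :: nat list set set)" by (rule countable_Collect_finite)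
  moreover have "to_nat_on (Collect finite) (level_set W k) = to_nat_on (Collect finite) (level_set W' k)"
    using assms(3) by (simp add: node_def)
  ultimately show ?thesis
    using finite_level_set[OF assms(1)] finite_level_set[OF assms(2)] by simp
qed

interpretation universal: weights universal_weights
proof
  show "0 \<le> \<phi> i" if "\<phi> \<in> universal_weights" for \<phi> i
    using that by (auto simp: universal_weights_def node_weight_def)
  show "\<phi> i \<le> 1" if "\<phi> \<in> universal_weights" for \<phi> i
  proof -
    have "real (v k) / 2 ^ k \<le> 1" if "dyadic v" for v k
      using that of_nat_mono[of "v k" "2 ^ k", where 'a = real] by (simp add: dyadic_def)
    then show ?thesis using that by (auto simp: universal_weights_def node_weight_def)
  qed
  show "(\<lambda>j. if j = i then 1 else 0) \<in> universal_weights" for i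
    by (auto simp: universal_weights_def)
qed

section \<open>Spaces with an unconditional frame embed complementably\<close>

text \<open>
  If \<open>U\<close> is a left inverse of \<open>T\<close>, then \<open>\<lambda>b. T (U b)\<close> is a projection onto the range of \<open>T\<close>.
\<close>

lemma complemented_of_retraction:
  assumes "normed_space X" "normed_space B"
    and T: "bounded_linear_map X B T" and U: "bounded_linear_map B X U"
    and UT: "\<And>x. x \<in> vecs X \<Longrightarrow> U (T x) = x"
  shows "\<exists>Z. complemented_subspace B Z \<and> isomorphic X Z"
proof (intro exI conjI)
  let ?P = "\<lambda>b. T (U b)"
  let ?Z = "B\<lparr>vecs := ?P ` vecs B\<rparr>"
  note T' = bounded_linear_mapD[OF T] and U' = bounded_linear_mapD[OF U]
  show "complemented_subspace B ?Z"
    unfolding complemented_subspace_def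
    using bounded_linear_map_comp[OF U T assms(2,1)] UT U'(1) by (intro exI[of _ ?P]) auto
  have "T ` vecs X \<subseteq> ?P ` vecs B"
  proof
    fix y assume "y \<in> T ` vecs X"
    then obtain x where "x \<in> vecs X" "y = T x" by blast
    then show "y \<in> ?P ` vecs B" using UT T'(1) by (intro image_eqI[of _ _ y]) auto
  qed
  then have TZ: "bounded_linear_map X ?Z T" using T by (simp add: bounded_linear_map_def)
  have PB: "?P ` vecs B \<subseteq> vecs B" using T' U' by auto
  obtain C where "\<And>b. b \<in> vecs B \<Longrightarrow> nrm X (U b) \<le> C * nrm B b"
    using bounded_linear_map_bound[OF U assms(2)] by blast
  then have "\<exists>C. \<forall>b\<in>?P ` vecs B. nrm X (U b) \<le> C * nrm B b" using PB by blast
  moreover have "U ` ?P ` vecs B \<subseteq> vecs X" using PB U'(1) by blast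
  moreover have "\<forall>x\<in>?P ` vecs B. \<forall>y\<in>?P ` vecs B. U (x + y) = U x + U y"
    using PB U'(2) by blast
  moreover have "\<forall>c. \<forall>x\<in>?P ` vecs B. U (scal B c x) = scal X c (U x)"
    using PB U'(3) by blast
  ultimately have "bounded_linear_map ?Z X U"
    unfolding bounded_linear_map_def by simp
  then show "isomorphic X ?Z"
    unfolding isomorphic_def using TZ UT U'(1) by (intro exI[of _ T] exI[of _ U]) auto
qed

context frame
begin

text \<open>
  The normalised vectors of the frame. As \<open>inverse 0 = 0\<close>, a vanishing \<open>v k\<close> gives the zero
  vector.
\<close>

definition unit_term :: "nat \<Rightarrow> 'a" where
  "unit_term k = scal X (of_real (inverse (nrm X (v k)))) (v k)"

text \<open>
  The dominated weights of the normalised frame vectors, rounded down to multiples of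
  \<open>1 / 2 ^ k\<close>. Rounding down keeps them dominated.
\<close>

definition rounded_weights :: "(nat \<Rightarrow> nat) set" where
  "rounded_weights = (\<lambda>w k. nat \<lfloor>2 ^ k * w k\<rfloor>) ` {w. dominated_weight X unit_term w}"

text \<open>
  The coefficients of \<open>x\<close> with respect to \<open>unit_term\<close>, placed on the branch of \<open>rounded_weights\<close>.
\<close>

definition embed :: "'a \<Rightarrow> nat \<Rightarrow> 'k" where
  "embed x i = (if i = node rounded_weights (level i)
     then of_real (nrm X (v (level i))) * f (level i) x else 0)"

text \<open>
  The series over the branch; it converges for all sequences of the space (see \<open>retract_sums\<close>).
\<close>

definition retract :: "(nat \<Rightarrow> 'k) \<Rightarrow> 'a" where
  "retract a = (THE x. sums_in X (\<lambda>k. scal X (a (node rounded_weights k)) (unit_term k)) x)"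

abbreviation (input) branch :: "nat \<Rightarrow> nat" where
  "branch \<equiv> node rounded_weights"

lemma unit_term_mem: "unit_term k \<in> vecs X"
  by (simp add: unit_term_def v_mem)

lemma scal_unit_term: "scal X (c * of_real (nrm X (v k))) (unit_term k) = scal X c (v k)"
proof (cases "v k = 0")
  case False
  then have "nrm X (v k) \<noteq> 0" using nrm_eq_0[OF v_mem] by blast
  then show ?thesis by (simp add: unit_term_def flip: of_real_mult of_real_inverse)
qed (simp add: unit_term_def)

lemma nrm_unit_term: "nrm X (unit_term k) \<le> 1"
  using v_mem nrm_nonneg[OF v_mem, of k] by (cases "nrm X (v k) = 0") (simp_all add: unit_term_def norm_inverse)

lemma dominated_weight_le_1: "dominated_weight X unit_term w \<Longrightarrow> w k \<le> 1"
  by (rule order_trans[OF dominated_weight_le_nrm[OF normed_space unit_term_mem] nrm_unit_term])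

lemma rounded_dyadic: "rounded_weights \<subseteq> Collect dyadic"
proof
  fix r assume "r \<in> rounded_weights"
  then obtain w where w: "dominated_weight X unit_term w" "r = (\<lambda>k. nat \<lfloor>2 ^ k * w k\<rfloor>)"
    by (auto simp: rounded_weights_def)
  have "nat \<lfloor>2 ^ k * w k\<rfloor> \<le> 2 ^ k" for k
  proof -
    have "2 ^ k * w k \<le> 2 ^ k" using dominated_weight_le_1[OF w(1)] by simp
    then have "\<lfloor>2 ^ k * w k\<rfloor> \<le> \<lfloor>2 ^ k :: real\<rfloor>" by (rule floor_mono)
    also have "\<lfloor>2 ^ k :: real\<rfloor> = 2 ^ k" by (metis floor_of_int of_int_numeral of_int_power)
    finally show ?thesis by (simp add: nat_le_iff)
  qed
  then show "r \<in> Collect dyadic" by (simp add: w(2) dyadic_def)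
qed

lemma embed_branch: "embed x (branch k) = of_real (nrm X (v k)) * f k x"
  by (simp add: embed_def)

lemma embed_off_branch: "i \<notin> range branch \<Longrightarrow> embed x i = 0"
  by (auto simp: embed_def)

text \<open>
  No universal weight gives more than an unconditional sum of the frame expansion. A weight from
  the branch of \<open>W\<close> acts only on the levels \<open>A'\<close> where that branch meets the branch of \<open>X\<close>. At the
  highest of these levels both have the same initial segments, so on \<open>A'\<close> the weight coincides
  with a rounded dominated weight of \<open>X\<close>.
\<close>

lemma universal_weight_on_branch:
  assumes \<phi>: "\<phi> \<in> universal_weights" and A: "finite A"
  obtains A' and \<epsilon> :: "nat \<Rightarrow> 'k" where "A' \<subseteq> A" "\<And>k. norm (\<epsilon> k) \<le> 1"
    "(\<Sum>k\<in>A. \<phi> (branch k) * norm (embed x (branch k)))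
       \<le> nrm X (\<Sum>k\<in>A'. scal X (\<epsilon> k * f k x) (v k))"
proof -
  define b where "b k = nrm X (v k) * norm (f k x)" for k
  have b0: "0 \<le> b k" for k using v_mem by (simp add: b_def)
  have eb: "norm (embed x (branch k)) = b k" for k
    using v_mem by (simp add: b_def norm_mult embed_branch)
  consider (node) W w where "W \<subseteq> Collect dyadic" "w \<in> W" "\<phi> = node_weight W w"
    | (coord) i where "\<phi> = (\<lambda>j. if j = i then 1 else 0)"
    using \<phi> by (auto simp: universal_weights_def)
  then show thesis
  proof cases
    case node
    define A' where "A' = {k \<in> A. branch k = node W k}"
    have A'A: "A' \<subseteq> A" and finA': "finite A'" using A by (auto simp: A'_def)
    have lhs: "(\<Sum>k\<in>A. \<phi> (branch k) * b k) = (\<Sum>k\<in>A'. w k / 2 ^ k * b k)"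
      unfolding A'_def using A by (simp add: node(3) node_weight_def sum.inter_filter if_distrib[of "\<lambda>t. t * _"] cong: if_cong)
    show thesis
    proof (cases "A' = {}")
      case True
      then show thesis using lhs by (intro that[of "{}" "\<lambda>_. 0"]) (auto simp: eb)
    next
      case False
      \<comment> \<open>One common initial segment, up to the highest meeting level, covers all of \<open>A'\<close>.\<close>
      define K where "K = Max A'"
      have "K \<in> A'" using False finA' by (simp add: K_def)
      then have "level_set rounded_weights K = level_set W K"
        using level_set_eq_of_node_eq[OF rounded_dyadic node(1)] by (simp add: A'_def)
      then have "map w [0..<Suc K] \<in> level_set rounded_weights K"
        using node(2) by (auto simp: level_set_def)
      then obtain r where r: "r \<in> rounded_weights" "map w [0..<Suc K] = map r [0..<Suc K]"
        by (auto simp: level_set_def)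
      have wr: "w k = r k" if "k \<in> A'" for k
      proof -
        have "k \<le> K" using that finA' by (simp add: K_def)
        then have "k \<in> set [0..<Suc K]" by auto
        then show ?thesis using r(2) unfolding map_eq_conv by blast
      qed
      obtain \<omega> where \<omega>: "dominated_weight X unit_term \<omega>" "r = (\<lambda>k. nat \<lfloor>2 ^ k * \<omega> k\<rfloor>)"
        using r(1) by (auto simp: rounded_weights_def)
      then obtain \<epsilon> where \<epsilon>: "\<And>k. norm (\<epsilon> k) \<le> 1" and dom: "\<And>A b. finite A \<Longrightarrow> (\<forall>i. 0 \<le> b i) \<Longrightarrow>
          (\<Sum>i\<in>A. \<omega> i * b i) \<le> nrm X (\<Sum>i\<in>A. scal X (\<epsilon> i * of_real (b i)) (unit_term i))"
        and \<omega>0: "\<And>k. 0 \<le> \<omega> k"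
        unfolding dominated_weight_def by blast
      have "r k / 2 ^ k \<le> \<omega> k" for k
      proof -
        have "real (nat \<lfloor>2 ^ k * \<omega> k\<rfloor>) \<le> 2 ^ k * \<omega> k" using \<omega>0[of k] by simp
        then show ?thesis by (simp add: \<omega>(2) divide_le_eq mult.commute)
      qed
      then have "(\<Sum>k\<in>A'. w k / 2 ^ k * b k) \<le> (\<Sum>k\<in>A'. \<omega> k * b k)"
        using b0 wr by (intro sum_mono mult_right_mono) auto
      also have "\<dots> \<le> nrm X (\<Sum>k\<in>A'. scal X (\<epsilon> k * of_real (b k)) (unit_term k))"
        using dom finA' b0 by blast
      also have "(\<Sum>k\<in>A'. scal X (\<epsilon> k * of_real (b k)) (unit_term k))
          = (\<Sum>k\<in>A'. scal X (\<epsilon> k * (of_real (norm (f k x)) / f k x) * f k x) (v k))"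
      proof (rule sum.cong[OF refl])
        fix k
        have "scal X (\<epsilon> k * of_real (b k)) (unit_term k) = scal X (\<epsilon> k * of_real (norm (f k x))) (v k)"
          using scal_unit_term[of "\<epsilon> k * of_real (norm (f k x))" k] by (simp add: b_def mult_ac)
        then show "scal X (\<epsilon> k * of_real (b k)) (unit_term k)
          = scal X (\<epsilon> k * (of_real (norm (f k x)) / f k x) * f k x) (v k)"
          by (cases "f k x = 0") auto
      qed
      \<comment> \<open>The phase of \<open>f k x\<close> is absorbed into the multiplier; for \<open>f k x = 0\<close> the quotient is 0.\<close>
      finally have "(\<Sum>k\<in>A'. w k / 2 ^ k * b k)
          \<le> nrm X (\<Sum>k\<in>A'. scal X (\<epsilon> k * (of_real (norm (f k x)) / f k x) * f k x) (v k))" .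
      moreover have "norm (\<epsilon> k * (of_real (norm (f k x)) / f k x)) \<le> 1" for k
        using \<epsilon>[of k] by (simp add: norm_mult norm_divide)
      ultimately show thesis
        using lhs A'A by (intro that[of A' "\<lambda>k. \<epsilon> k * (of_real (norm (f k x)) / f k x)"]) (simp_all add: eb)
    qed
  next
    case coord
    show thesis
    proof (cases "i \<in> branch ` A")
      case True
      then obtain k where k: "k \<in> A" "i = branch k" by blast
      have "(\<Sum>j\<in>A. \<phi> (branch j) * b j) = (\<Sum>j\<in>A. if j = k then b k else 0)"
        using inj_node by (intro sum.cong) (auto simp: coord k(2) inj_eq)
      then have "(\<Sum>j\<in>A. \<phi> (branch j) * b j) = b k" using A k by simp
      then show thesis using k v_mem
        by (intro that[of "{k}" "\<lambda>_. 1"]) (auto simp: eb b_def mult.commute)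
    next
      case False
      then have "(\<Sum>j\<in>A. \<phi> (branch j) * b j) = 0"
        by (intro sum.neutral) (auto simp: coord)
      then show thesis by (intro that[of "{}" "\<lambda>_. 0"]) (auto simp: eb)
    qed
  qed
qed

text \<open>
  Norms of coefficient sequences are reduced to multiplied sums of the frame expansion over
  levels whose nodes lie beyond \<open>M\<close>.
\<close>

lemma wbound_tail_embed:
  assumes le: "\<And>A \<epsilon>. finite A \<Longrightarrow> (\<And>k. k \<in> A \<Longrightarrow> M \<le> branch k) \<Longrightarrow> (\<And>k. norm (\<epsilon> k) \<le> 1) \<Longrightarrow>
    nrm X (\<Sum>k\<in>A. scal X (\<epsilon> k * f k x) (v k)) \<le> c"
  shows "wbound universal_weights (tail M (embed x)) c"
  unfolding wbound_def
proof (intro ballI allI)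
  fix \<phi> n assume \<phi>: "\<phi> \<in> universal_weights"
  let ?A = "{k. M \<le> branch k \<and> branch k < n}"
  have "?A \<subseteq> {..<n}"
  proof
    fix k assume "k \<in> ?A"
    then show "k \<in> {..<n}" using le_node[of k rounded_weights] by simp
  qed
  then have A: "finite ?A" using finite_subset by blast
  obtain A' and \<epsilon> :: "nat \<Rightarrow> 'k" where A': "A' \<subseteq> ?A" "\<And>k. norm (\<epsilon> k) \<le> 1"
    "(\<Sum>k\<in>?A. \<phi> (branch k) * norm (embed x (branch k)))
       \<le> nrm X (\<Sum>k\<in>A'. scal X (\<epsilon> k * f k x) (v k))"
    by (rule universal_weight_on_branch[OF \<phi> A, where x = x]) blast
  have "tail M (embed x) i = 0" if "i \<in> {..<n} - branch ` ?A" for i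
    using that embed_off_branch[of i x] by (cases "i \<in> range branch") (auto simp: tail_def)
  then have "(\<Sum>i<n. \<phi> i * norm (tail M (embed x) i)) = (\<Sum>i\<in>branch ` ?A. \<phi> i * norm (embed x i))"
    by (intro sum.mono_neutral_cong_right) (auto simp: tail_def)
  also have "\<dots> = (\<Sum>k\<in>?A. \<phi> (branch k) * norm (embed x (branch k)))"
    by (subst sum.reindex) (auto intro: inj_on_subset[OF inj_node])
  also have "\<dots> \<le> nrm X (\<Sum>k\<in>A'. scal X (\<epsilon> k * f k x) (v k))" by (rule A'(3))
  also have "\<dots> \<le> c" using A' finite_subset[OF A'(1) A] by (intro le) auto
  finally show "(\<Sum>i<n. \<phi> i * norm (tail M (embed x) i)) \<le> c" .
qed

lemma embed_mem:
  assumes x: "x \<in> vecs X"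
  shows "embed x \<in> vecs (wspace universal_weights)"
  unfolding universal.vecs_wspace_iff
proof (intro allI impI)
  fix e :: real assume e: "e > 0"
  show "\<exists>N. wbound universal_weights (tail N (embed x)) e"
  proof (rule multiplier_small_tails[OF x e])
    fix N assume N: "\<And>A \<epsilon>. finite A \<Longrightarrow> A \<subseteq> {N..} \<Longrightarrow> (\<And>i. norm (\<epsilon> i) \<le> 1) \<Longrightarrow>
        nrm X (\<Sum>i\<in>A. scal X (\<epsilon> i * f i x) (v i)) \<le> e"
    \<comment> \<open>A coordinate beyond \<open>?M\<close> on the branch can only belong to a level at or above \<open>N\<close>.\<close>
    let ?M = "Suc (\<Sum>k<N. branch k)"
    have kN: "N \<le> k" if "?M \<le> branch k" for k
    proof (rule ccontr)
      assume "\<not> N \<le> k"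
      then have "branch k \<le> (\<Sum>k<N. branch k)" by (intro member_le_sum) auto
      then show False using that by simp
    qed
    have "wbound universal_weights (tail ?M (embed x)) e"
    proof (rule wbound_tail_embed)
      fix A and \<epsilon> :: "nat \<Rightarrow> 'k"
      assume A: "finite A" "\<And>k. k \<in> A \<Longrightarrow> ?M \<le> branch k" and \<epsilon>: "\<And>k. norm (\<epsilon> k) \<le> 1"
      have "A \<subseteq> {N..}" using kN A(2) by (intro subsetI) (simp only: atLeast_iff)
      then show "nrm X (\<Sum>k\<in>A. scal X (\<epsilon> k * f k x) (v k)) \<le> e" by (rule N[OF A(1) _ \<epsilon>])
    qed
    then show ?thesis by blast
  qed
qed

lemma embed_bounded: "\<exists>K. \<forall>x\<in>vecs X. nrm (wspace universal_weights) (embed x) \<le> K * nrm X x"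
proof (rule multiplier_bound)
  fix K assume K: "\<And>A \<epsilon> x. finite A \<Longrightarrow> x \<in> vecs X \<Longrightarrow> (\<And>i. norm (\<epsilon> i) \<le> 1) \<Longrightarrow>
      nrm X (\<Sum>i\<in>A. scal X (\<epsilon> i * f i x) (v i)) \<le> K * nrm X x"
  have "nrm (wspace universal_weights) (embed x) \<le> K * nrm X x" if x: "x \<in> vecs X" for x
  proof -
    have "wbound universal_weights (tail 0 (embed x)) (K * nrm X x)"
      by (rule wbound_tail_embed) (rule K[OF _ x])
    then show ?thesis by (intro universal.nrm_wspace_least) (simp add: tail_def)
  qed
  then show ?thesis by blast
qed

lemma bounded_linear_embed: "bounded_linear_map X (wspace universal_weights) embed"
proof -
  note f = f_dual[unfolded topological_dual_def mem_Collect_eq]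
  have "embed (x + y) = embed x + embed y" if "x \<in> vecs X" "y \<in> vecs X" for x y
    using bounded_linear_mapD(2)[OF f that] by (auto simp: embed_def fun_eq_iff algebra_simps)
  moreover have "embed (scal X c x) = scal (wspace universal_weights) c (embed x)"
    if "x \<in> vecs X" for c x
    using bounded_linear_mapD(3)[OF f that] by (auto simp: embed_def fun_eq_iff scalar_space_def)
  ultimately show ?thesis
    unfolding bounded_linear_map_def using embed_mem embed_bounded by blast
qed

text \<open>
  A norming weight is replaced by its rounding, which is a universal weight and contributes at
  most \<open>c\<close>. The rounding error at level \<open>k\<close> is at most \<open>1 / 2 ^ k\<close>, and coordinates are bounded by
  \<open>c\<close>, so that the errors contribute at most \<open>2 * c\<close>.
\<close>

lemma synthesis_bound:
  assumes a: "wbound universal_weights a c" and A: "finite A"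
  shows "nrm X (\<Sum>k\<in>A. scal X (a (branch k)) (unit_term k)) \<le> 3 * c"
proof -
  obtain w where w: "dominated_weight X unit_term w" and
    le: "nrm X (\<Sum>k\<in>A. scal X (a (branch k)) (unit_term k)) \<le> (\<Sum>k\<in>A. w k * norm (a (branch k)))"
    by (rule norming_weight[OF normed_space unit_term_mem A, where c = "\<lambda>k. a (branch k)"])
  define r where "r = (\<lambda>k. nat \<lfloor>2 ^ k * w k\<rfloor>)"
  have r: "r \<in> rounded_weights" using w by (auto simp: r_def rounded_weights_def)
  have wr: "w k \<le> r k / 2 ^ k + (1 / 2) ^ k" for k
  proof -
    have "2 ^ k * w k \<le> real (r k) + 1" unfolding r_def by linarith
    then show ?thesis by (simp add: field_simps)
  qed
  have ac: "norm (a i) \<le> c" for i by (rule universal.wbound_coordinate[OF a])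
  then have c: "0 \<le> c" using norm_ge_zero order_trans by blast
  have "node_weight rounded_weights r \<in> universal_weights"
    using r rounded_dyadic by (auto simp: universal_weights_def)
  moreover define n where "n = Suc (\<Sum>k\<in>A. branch k)"
  ultimately have "(\<Sum>i<n. node_weight rounded_weights r i * norm (a i)) \<le> c"
    using a unfolding wbound_def by blast
  moreover have "(\<Sum>i\<in>branch ` A. node_weight rounded_weights r i * norm (a i))
      \<le> (\<Sum>i<n. node_weight rounded_weights r i * norm (a i))"
  proof (rule sum_mono2)
    show "branch ` A \<subseteq> {..<n}" using A member_le_sum[of _ A branch] by (auto simp: n_def less_Suc_eq_le)
  qed (auto simp: node_weight_def)
  moreover have "(\<Sum>i\<in>branch ` A. node_weight rounded_weights r i * norm (a i))
      = (\<Sum>k\<in>A. r k / 2 ^ k * norm (a (branch k)))"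
    by (subst sum.reindex) (auto intro: inj_on_subset[OF inj_node] simp: node_weight_def)
  ultimately have 1: "(\<Sum>k\<in>A. r k / 2 ^ k * norm (a (branch k))) \<le> c" by linarith
  have "(\<Sum>k\<in>A. (1 / 2) ^ k * norm (a (branch k))) \<le> (\<Sum>k\<in>A. (1 / 2) ^ k * c)"
    using ac by (intro sum_mono mult_left_mono) auto
  also have "\<dots> = (\<Sum>k\<in>A. (1 / 2) ^ k) * c" by (simp add: sum_distrib_right)
  also have "(\<Sum>k\<in>A. (1 / 2) ^ k) \<le> (\<Sum>k. (1 / 2 :: real) ^ k)"
    using A by (intro sum_le_suminf summable_geometric) auto
  then have "(\<Sum>k\<in>A. (1 / 2) ^ k) * c \<le> 2 * c"
    using c by (intro mult_right_mono) (simp_all add: suminf_geometric)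
  finally have 2: "(\<Sum>k\<in>A. (1 / 2) ^ k * norm (a (branch k))) \<le> 2 * c" .
  have "(\<Sum>k\<in>A. w k * norm (a (branch k)))
      \<le> (\<Sum>k\<in>A. (r k / 2 ^ k + (1 / 2) ^ k) * norm (a (branch k)))"
    using wr by (intro sum_mono mult_right_mono) auto
  also have "\<dots> \<le> 3 * c" using 1 2 by (simp add: distrib_right sum.distrib)
  finally show ?thesis using le by linarith
qed

lemma retract_sums:
  assumes a: "a \<in> vecs (wspace universal_weights)"
  shows "sums_in X (\<lambda>k. scal X (a (branch k)) (unit_term k)) (retract a)"
proof -
  have range: "range (\<lambda>k. scal X (a (branch k)) (unit_term k)) \<subseteq> vecs X"
    using unit_term_mem by blast
  have "\<exists>x. sums_in X (\<lambda>k. scal X (a (branch k)) (unit_term k)) x"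
  proof (rule series_converges[OF range])
    fix e :: real assume "e > 0"
    then obtain N where N: "wbound universal_weights (tail N a) (e / 3)"
      using a unfolding universal.vecs_wspace_iff by (meson divide_pos_pos zero_less_numeral)
    have "nrm X (\<Sum>k\<in>{m..<n}. scal X (a (branch k)) (unit_term k)) \<le> e" if "m \<ge> N" for m n
    proof -
      have "tail N a (branch k) = a (branch k)" if "k \<ge> m" for k
        using le_node[of k rounded_weights] that \<open>m \<ge> N\<close> by (simp add: tail_def)
      then have "(\<Sum>k\<in>{m..<n}. scal X (tail N a (branch k)) (unit_term k))
          = (\<Sum>k\<in>{m..<n}. scal X (a (branch k)) (unit_term k))"
        by (intro sum.cong) auto
      then show ?thesis using synthesis_bound[OF N, of "{m..<n}"] by simp
    qed
    then show "\<exists>N. \<forall>m\<ge>N. \<forall>n\<ge>m. nrm X (\<Sum>k\<in>{m..<n}. scal X (a (branch k)) (unit_term k)) \<le> e"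
      by blast
  qed
  then show ?thesis
    unfolding retract_def using sums_in_unique[OF _ _ range] by (blast intro: theI)
qed

lemma retract_eqI:
  assumes "sums_in X (\<lambda>k. scal X (a (branch k)) (unit_term k)) x"
  shows "retract a = x"
  unfolding retract_def
  using assms by (rule the_equality) (rule sums_in_unique[OF _ assms], auto simp: unit_term_mem)

lemma bounded_linear_retract: "bounded_linear_map (wspace universal_weights) X retract"
proof -
  let ?B = "wspace universal_weights :: ('k, nat \<Rightarrow> 'k) nspace"
  have range: "range (\<lambda>k. scal X (c k) (unit_term k)) \<subseteq> vecs X" for c :: "nat \<Rightarrow> 'k"
    using unit_term_mem by blast
  have "retract a \<in> vecs X" if "a \<in> vecs ?B" for a
    using retract_sums[OF that] sums_in_mem by blast
  moreover have "retract (a + b) = retract a + retract b" if ab: "a \<in> vecs ?B" "b \<in> vecs ?B" for a b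
  proof (rule retract_eqI)
    show "sums_in X (\<lambda>k. scal X ((a + b) (branch k)) (unit_term k)) (retract a + retract b)"
      using sums_in_add[OF retract_sums[OF ab(1)] retract_sums[OF ab(2)] range range]
      by (simp add: scale_left_distrib)
  qed
  moreover have "retract (scal ?B c a) = scal X c (retract a)" if a: "a \<in> vecs ?B" for c a
  proof (rule retract_eqI)
    show "sums_in X (\<lambda>k. scal X (scal ?B c a (branch k)) (unit_term k)) (scal X c (retract a))"
      using bounded_linear_map_sums[OF bounded_linear_scal normed_space normed_space
          retract_sums[OF a] range, of c] by simp
  qed
  moreover have "nrm X (retract a) \<le> 3 * nrm ?B a" if a: "a \<in> vecs ?B" for a
  proof (rule nrm_limit_le[OF retract_sums[OF a, unfolded sums_in_def]])
    show "range (\<lambda>n. \<Sum>k<n. scal X (a (branch k)) (unit_term k)) \<subseteq> vecs X"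
      using unit_term_mem by (intro image_subsetI sum_mem scal_mem)
    show "nrm X (\<Sum>k<n. scal X (a (branch k)) (unit_term k)) \<le> 3 * nrm ?B a" for n
      by (rule synthesis_bound[OF universal.wbound_nrm[OF a]]) simp
  qed
  ultimately show ?thesis unfolding bounded_linear_map_def by blast
qed

lemma retract_embed:
  assumes "x \<in> vecs X"
  shows "retract (embed x) = x"
proof (rule retract_eqI)
  have "scal X (embed x (branch k)) (unit_term k) = scal X (f k x) (v k)" for k
    using scal_unit_term[of "f k x" k] by (simp add: embed_branch mult.commute)
  then show "sums_in X (\<lambda>k. scal X (embed x (branch k)) (unit_term k)) x"
    using unconditionally_sums_imp_sums[OF expansion[OF assms]] by simp
qed

theorem complemented_in_universal:
  "\<exists>Z. complemented_subspace (wspace universal_weights :: ('k, nat \<Rightarrow> 'k) nspace) Z \<and> isomorphic X Z"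
  using normed_space universal.normed_space_wspace bounded_linear_embed bounded_linear_retract
  by (rule complemented_of_retraction) (rule retract_embed)

end

section \<open>Coefficient functionals of a Schauder basis\<close>

locale basis = banach_nspace B
  for B :: "('k::{real_normed_field,euclidean_space}, 'b::ab_group_add) nspace" +
  fixes b :: "nat \<Rightarrow> 'b"
  assumes schauder: "schauder_basis B b"
begin

definition coeff :: "'b \<Rightarrow> nat \<Rightarrow> 'k" where
  "coeff x = (THE \<alpha>. sums_in B (\<lambda>n. scal B (\<alpha> n) (b n)) x)"

abbreviation partial :: "nat \<Rightarrow> 'b \<Rightarrow> 'b" where
  "partial n x \<equiv> (\<Sum>i<n. scal B (coeff x i) (b i))"

lemma basis_mem: "b n \<in> vecs B"
  using schauder unfolding schauder_basis_def by blast

lemma terms_mem: "range (\<lambda>n. scal B (\<alpha> n) (b n)) \<subseteq> vecs B"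
  using basis_mem by blast

lemma combination_mem: "(\<Sum>i\<in>A. scal B (\<alpha> i) (b i)) \<in> vecs B"
  using basis_mem by (intro sum_mem scal_mem)

lemma expansion_ex1: "x \<in> vecs B \<Longrightarrow> \<exists>!\<alpha>. sums_in B (\<lambda>n. scal B (\<alpha> n) (b n)) x"
  using schauder by (simp add: schauder_basis_def)

lemma coeff_sums: "x \<in> vecs B \<Longrightarrow> sums_in B (\<lambda>n. scal B (coeff x n) (b n)) x"
  unfolding coeff_def by (rule theI'[OF expansion_ex1])

lemma coeff_unique:
  assumes "sums_in B (\<lambda>n. scal B (\<alpha> n) (b n)) x"
  shows "coeff x = \<alpha>"
  unfolding coeff_def
  by (rule the1_equality) (rule expansion_ex1[OF sums_in_mem[OF assms]], rule assms)

lemma coeff_add: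
  assumes "x \<in> vecs B" "y \<in> vecs B"
  shows "coeff (x + y) = (\<lambda>n. coeff x n + coeff y n)"
  using sums_in_add[OF coeff_sums[OF assms(1)] coeff_sums[OF assms(2)] terms_mem terms_mem]
  by (intro coeff_unique) (simp add: scale_left_distrib)

lemma coeff_scal:
  assumes "x \<in> vecs B"
  shows "coeff (scal B c x) = (\<lambda>n. c * coeff x n)"
  using bounded_linear_map_sums[OF bounded_linear_scal normed_space normed_space
      coeff_sums[OF assms] terms_mem, of c]
  by (intro coeff_unique) simp

lemma coeff_zero: "coeff 0 = (\<lambda>n. 0)"
  by (rule coeff_unique) (simp add: sums_in_def converges_in_const)

lemma basis_nonzero: "b n \<noteq> 0"
proof
  assume "b n = 0"
  then have "(\<lambda>i. scal B (if i = n then 1 else 0) (b i)) = (\<lambda>i. 0)" by auto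
  then have "sums_in B (\<lambda>i. scal B (if i = n then 1 else 0) (b i)) 0"
    by (simp add: sums_in_def converges_in_const)
  then have "coeff 0 = (\<lambda>i. if i = n then 1 else 0)" by (rule coeff_unique)
  then show False using coeff_zero by (metis zero_neq_one)
qed

lemma basis_nrm_pos: "0 < nrm B (b n)"
  using nrm_eq_0[OF basis_mem] basis_nonzero nrm_nonneg[OF basis_mem] by (metis order_less_le)

lemma partial_add:
  "x \<in> vecs B \<Longrightarrow> y \<in> vecs B \<Longrightarrow> partial n (x + y) = partial n x + partial n y"
  by (simp add: coeff_add scale_left_distrib sum.distrib)

lemma partial_sum:
  fixes J :: nat
  assumes "\<And>j. a j \<in> vecs B"
  shows "partial n (\<Sum>j<J. a j) = (\<Sum>j<J. partial n (a j))"
proof (induction J)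
  case 0 then show ?case by (simp add: coeff_zero)
next
  case (Suc J)
  have "(\<Sum>j<J. a j) \<in> vecs B" using assms by (intro sum_mem)
  from partial_add[OF this assms[of J], of n] show ?case using Suc by simp
qed

text \<open>
  The classical norm that makes all partial sum projections contractions. Its boundedness with
  respect to the original norm is the continuity of the coefficient functionals.
\<close>

definition basis_norm :: "'b \<Rightarrow> real" where
  "basis_norm x = (SUP n. nrm B (partial n x))"

lemma partial_bounded: "x \<in> vecs B \<Longrightarrow> bdd_above (range (\<lambda>n. nrm B (partial n x)))"
proof -
  assume x: "x \<in> vecs B"
  have "(\<lambda>n. nrm B (partial n x - x)) \<longlonglongrightarrow> 0"
    using coeff_sums[OF x] by (simp add: sums_in_def converges_in_def)
  then have "Bseq (\<lambda>n. nrm B (partial n x - x))" using convergentI convergent_imp_Bseq by blast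
  then obtain K where K: "\<And>n. norm (nrm B (partial n x - x)) \<le> K" by (meson BseqE)
  have "nrm B (partial n x) \<le> K + nrm B x" for n
    using nrm_le_add_diff[OF combination_mem x, of "coeff x" "{..<n}"] K[of n] by simp
  then show ?thesis by (intro bdd_aboveI2)
qed

lemma partial_le_basis_norm: "x \<in> vecs B \<Longrightarrow> nrm B (partial n x) \<le> basis_norm x"
  unfolding basis_norm_def by (rule cSUP_upper[OF UNIV_I partial_bounded])

lemma basis_norm_least: "(\<And>n. nrm B (partial n x) \<le> c) \<Longrightarrow> basis_norm x \<le> c"
  unfolding basis_norm_def by (rule cSUP_least) auto

lemma basis_norm_nonneg: "x \<in> vecs B \<Longrightarrow> 0 \<le> basis_norm x"
  using partial_le_basis_norm[of x 0] by simp

lemma coeff_le_basis_norm: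
  assumes "x \<in> vecs B"
  shows "norm (coeff x n) \<le> 2 * basis_norm x / nrm B (b n)"
proof -
  have "norm (coeff x n) * nrm B (b n) = nrm B (partial (Suc n) x - partial n x)"
    using basis_mem by simp
  also have "\<dots> \<le> nrm B (partial (Suc n) x) + nrm B (partial n x)"
    by (rule nrm_diff[OF combination_mem combination_mem])
  also have "\<dots> \<le> 2 * basis_norm x"
    using partial_le_basis_norm[OF assms, of n] partial_le_basis_norm[OF assms, of "Suc n"] by linarith
  finally show ?thesis using basis_nrm_pos[of n] by (simp add: pos_le_divide_eq)
qed

lemma sums_in_scal_left:
  assumes "c sums C" "x \<in> vecs B"
  shows "sums_in B (\<lambda>j. scal B (c j) x) (scal B C x)"
proof -
  have "(\<Sum>j<n. scal B (c j) x) - scal B C x = scal B ((\<Sum>j<n. c j) - C) x" for n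
    by (simp add: scale_sum_left scale_left_diff_distrib)
  then have "nrm B ((\<Sum>j<n. scal B (c j) x) - scal B C x) = norm ((\<Sum>j<n. c j) - C) * nrm B x" for n
    using assms(2) by simp
  moreover have "(\<lambda>n. norm ((\<Sum>j<n. c j) - C) * nrm B x) \<longlonglongrightarrow> 0 * nrm B x"
    using assms(1) unfolding sums_def by (intro tendsto_mult tendsto_const) (simp add: LIM_zero_iff tendsto_norm_zero_iff)
  ultimately show ?thesis using assms(2) by (simp add: sums_in_def converges_in_def)
qed

text \<open>
  If \<open>x\<close> is the sum of the \<open>a j\<close> and their basis norms are summable, then the coefficients of the
  \<open>a j\<close> are summable to numbers \<open>\<beta> i\<close>. The partial sums of \<open>\<Sum>i. \<beta> i * b i\<close> are, uniformly in \<open>n\<close>,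
  limits of partial sums of finitely many \<open>a j\<close>, so they converge to \<open>x\<close>. By uniqueness of
  the expansion, \<open>\<beta>\<close> consists of the coefficients of \<open>x\<close>.
\<close>

lemma basis_norm_countably_subadditive:
  assumes a: "range a \<subseteq> vecs B" and x: "sums_in B a x" and summ: "summable (\<lambda>n. basis_norm (a n))"
  shows "basis_norm x \<le> (\<Sum>n. basis_norm (a n))"
proof -
  have aj: "a j \<in> vecs B" for j using a by auto
  define \<beta> where "\<beta> i = (\<Sum>j. coeff (a j) i)" for i
  have \<beta>: "(\<lambda>j. coeff (a j) i) sums \<beta> i" for i
    unfolding \<beta>_def
  proof (rule summable_sums, rule summable_comparison_test')
    show "summable (\<lambda>j. 2 * basis_norm (a j) / nrm B (b i))"
      by (intro summable_divide summable_mult summ)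
    show "norm (coeff (a j) i) \<le> 2 * basis_norm (a j) / nrm B (b i)" if "j \<ge> 0" for j
      by (rule coeff_le_basis_norm[OF aj])
  qed
  let ?R = "\<lambda>n. \<Sum>i<n. scal B (\<beta> i) (b i)"
  have R: "sums_in B (\<lambda>j. partial n (a j)) (?R n)" for n
  proof (induction n)
    case 0 then show ?case by (simp add: sums_in_def converges_in_const)
  next
    case (Suc n)
    have "sums_in B (\<lambda>j. partial n (a j) + scal B (coeff (a j) n) (b n)) (?R n + scal B (\<beta> n) (b n))"
      using combination_mem basis_mem
      by (intro sums_in_add Suc sums_in_scal_left \<beta> image_subsetI scal_mem) auto
    then show ?case by simp
  qed
  have part: "nrm B (\<Sum>j\<in>{J..<M}. partial n (a j)) \<le> (\<Sum>j\<in>{J..<M}. basis_norm (a j))" for n J M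
    by (rule order_trans[OF nrm_sum sum_mono])
      (rule combination_mem, rule partial_le_basis_norm[OF aj])
  have pmem: "(\<Sum>j\<in>A. partial n (a j)) \<in> vecs B" for n A
    by (rule sum_mem) (rule combination_mem)
  \<comment> \<open>This bound is uniform in \<open>n\<close>, which allows the exchange of the two limits below.\<close>
  have R_tail: "nrm B (?R n - (\<Sum>j<J. partial n (a j))) \<le> c"
    if c: "\<And>M. (\<Sum>j\<in>{J..<M}. basis_norm (a j)) \<le> c" for n J c
  proof (rule nrm_limit_le)
    let ?y = "\<Sum>j<J. partial n (a j)"
    have "converges_in B (\<lambda>M. (\<Sum>j<M. partial n (a j)) + - ?y) (?R n + - ?y)"
    proof (rule converges_in_add[OF R[unfolded sums_in_def] converges_in_const])
      show "- ?y \<in> vecs B" by (rule minus_mem[OF pmem])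
      then show "range (\<lambda>M::nat. - ?y) \<subseteq> vecs B" by blast
      show "range (\<lambda>M. \<Sum>j<M. partial n (a j)) \<subseteq> vecs B" using pmem by blast
    qed
    then show "converges_in B (\<lambda>M. (\<Sum>j<M. partial n (a j)) - ?y) (?R n - ?y)" by simp
    show "range (\<lambda>M. (\<Sum>j<M. partial n (a j)) - ?y) \<subseteq> vecs B" using diff_mem[OF pmem pmem] by blast
    fix M assume "M \<ge> J"
    then have eq: "(\<Sum>j<M. partial n (a j)) - ?y = (\<Sum>j\<in>{J..<M}. partial n (a j))"
      using sum_diff_nat_ivl[of 0 J M "\<lambda>j. partial n (a j)"] by (simp add: lessThan_atLeast0)
    show "nrm B ((\<Sum>j<M. partial n (a j)) - ?y) \<le> c"
      unfolding eq by (rule order_trans[OF part c])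
  qed
  have xB: "x \<in> vecs B" using x sums_in_mem by blast
  have "sums_in B (\<lambda>i. scal B (\<beta> i) (b i)) x"
    unfolding sums_in_def
  proof (rule converges_inI[OF xB])
    show "range ?R \<subseteq> vecs B" using combination_mem by blast
    fix e :: real assume e: "e > 0"
    have e3: "e / 3 > 0" using e by simp
    obtain J1 where J1: "\<forall>m\<ge>J1. \<forall>n. norm (\<Sum>j\<in>{m..<n}. basis_norm (a j)) < e / 3"
      using summ[unfolded summable_Cauchy, rule_format, OF e3] ..
    have amem: "(\<Sum>j<J. a j) \<in> vecs B" for J using aj by (intro sum_mem)
    obtain J2 where J2: "\<And>J. J \<ge> J2 \<Longrightarrow> nrm B ((\<Sum>j<J. a j) - x) < e / 3"
      by (rule converges_inD[OF x[unfolded sums_in_def] e3]) (use amem in blast)+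
    define J where "J = max J1 J2"
    let ?y = "\<Sum>j<J. a j"
    obtain N where N: "\<And>n. n \<ge> N \<Longrightarrow> nrm B (partial n ?y - ?y) < e / 3"
      by (rule converges_inD[OF coeff_sums[OF amem, unfolded sums_in_def] e3, of J])
        (use combination_mem in blast)+
    have "nrm B (?R n - x) \<le> e" if "n \<ge> N" for n
    proof -
      have "nrm B (?R n - partial n ?y) \<le> e / 3"
        unfolding partial_sum[OF aj]
      proof (rule R_tail)
        show "(\<Sum>j\<in>{J..<M}. basis_norm (a j)) \<le> e / 3" for M
          using J1[rule_format, of J M] by (simp add: J_def)
      qed
      moreover have "nrm B (?R n - x) \<le> nrm B (?R n - partial n ?y) + nrm B (partial n ?y - x)"
        by (rule nrm_triangle[OF combination_mem combination_mem xB])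
      moreover have "nrm B (partial n ?y - x) \<le> nrm B (partial n ?y - ?y) + nrm B (?y - x)"
        by (rule nrm_triangle[OF combination_mem amem xB])
      moreover have "nrm B (?y - x) < e / 3" by (rule J2) (simp add: J_def)
      ultimately show ?thesis using N[OF that] by linarith
    qed
    then show "\<exists>N. \<forall>n\<ge>N. nrm B (?R n - x) \<le> e" by blast
  qed
  then have "coeff x = \<beta>" by (rule coeff_unique)
  then have "nrm B (partial n x) \<le> (\<Sum>j. basis_norm (a j))" for n
    using R_tail[of 0 "\<Sum>j. basis_norm (a j)" n] summ basis_norm_nonneg[OF aj]
    by (simp add: sum_le_suminf)
  then show ?thesis by (rule basis_norm_least)
qed

theorem coeff_dual: "(\<lambda>x. coeff x n) \<in> topological_dual B"
proof -
  have "\<exists>C\<ge>0. \<forall>x\<in>vecs B. basis_norm x \<le> C * nrm B x"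
  proof (rule zabreiko[of basis_norm])
    show "0 \<le> basis_norm x" if "x \<in> vecs B" for x by (rule basis_norm_nonneg[OF that])
    show "basis_norm (scal B c x) \<le> norm c * basis_norm x" if x: "x \<in> vecs B" for c x
    proof (rule basis_norm_least)
      fix n
      have "partial n (scal B c x) = scal B c (partial n x)"
        by (simp add: coeff_scal[OF x] scale_sum_right)
      then have "nrm B (partial n (scal B c x)) = norm c * nrm B (partial n x)"
        using combination_mem by simp
      then show "nrm B (partial n (scal B c x)) \<le> norm c * basis_norm x"
        using partial_le_basis_norm[OF x, of n] by (simp add: mult_left_mono)
    qed
    show "basis_norm (x + y) \<le> basis_norm x + basis_norm y" if x: "x \<in> vecs B" and y: "y \<in> vecs B" for x y
    proof (rule basis_norm_least)
      show "nrm B (partial n (x + y)) \<le> basis_norm x + basis_norm y" for n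
        unfolding partial_add[OF x y]
        using nrm_add[OF combination_mem combination_mem, of "coeff x" "{..<n}" "coeff y" "{..<n}"]
          partial_le_basis_norm[OF x, of n] partial_le_basis_norm[OF y, of n] by linarith
    qed
    show "basis_norm x \<le> (\<Sum>n. basis_norm (a n))"
      if "range a \<subseteq> vecs B" "sums_in B a x" "summable (\<lambda>n. basis_norm (a n))" for x a
      using that by (rule basis_norm_countably_subadditive)
  qed blast
  then obtain C where C: "\<And>x. x \<in> vecs B \<Longrightarrow> basis_norm x \<le> C * nrm B x" by blast
  have "norm (coeff x n) \<le> (2 * C / nrm B (b n)) * nrm B x" if x: "x \<in> vecs B" for x
  proof -
    have "2 * basis_norm x / nrm B (b n) \<le> 2 * (C * nrm B x) / nrm B (b n)"
      using C[OF x] basis_nrm_pos[of n] by (intro divide_right_mono) auto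
    then show ?thesis using coeff_le_basis_norm[OF x, of n] by simp
  qed
  then show ?thesis
    unfolding topological_dual_def bounded_linear_map_def
    by (auto simp: scalar_space_def coeff_add coeff_scal intro!: exI[of _ "2 * C / nrm B (b n)"])
qed

end

section \<open>Complemented subspaces\<close>

text \<open>
  The range of a projection is its set of fixed points, hence closed.
\<close>

lemma complemented_subspaceE:
  assumes "complemented_subspace B Z" "banach_space B"
  obtains P where "bounded_linear_map B B P" "bounded_linear_map B Z P"
    "\<And>z. z \<in> vecs Z \<Longrightarrow> P z = z" "vecs Z \<subseteq> vecs B" "Z = B\<lparr>vecs := vecs Z\<rparr>" "banach_space Z"
proof -
  interpret banach_nspace B by (rule banach_nspaceI) fact
  obtain P where P: "bounded_linear_map B B P" "\<forall>x\<in>vecs B. P (P x) = P x" "Z = B\<lparr>vecs := P ` vecs B\<rparr>"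
    using assms(1) unfolding complemented_subspace_def by (elim exE conjE) (rule that)
  note P' = bounded_linear_mapD[OF P(1)]
  have vZ: "vecs Z = P ` vecs B" and sZ: "scal Z = scal B" and nZ: "nrm Z = nrm B" by (simp_all add: P(3))
  have ZB: "vecs Z \<subseteq> vecs B" unfolding vZ using P'(1) by blast
  have fix_Z: "P z = z" if "z \<in> vecs Z" for z using that P(2) unfolding vZ by auto
  have mem_iff: "z \<in> vecs Z" if "z \<in> vecs B" "P z = z" for z using that unfolding vZ by (metis image_eqI)
  have sub: "subspace (vecs Z)"
  proof (rule subspaceI)
    show "0 \<in> vecs Z" by (rule mem_iff) (auto simp: bounded_linear_map_zero[OF P(1) normed_space])
    show "x + y \<in> vecs Z" if "x \<in> vecs Z" "y \<in> vecs Z" for x y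
      using that ZB fix_Z P'(2)[of x y] by (intro mem_iff) auto
    show "scal B c x \<in> vecs Z" if "x \<in> vecs Z" for c x
      using that ZB fix_Z P'(3)[of x c] by (intro mem_iff) auto
  qed
  have nsZ: "normed_space Z"
    using normed_space sub ZB unfolding normed_space_def sZ nZ by (auto simp: subset_iff)
  have "\<exists>z. converges_in Z s z" if s: "range s \<subseteq> vecs Z" "cauchy_in Z s" for s
  proof -
    have sB: "range s \<subseteq> vecs B" using s(1) ZB by blast
    have "cauchy_in B s" using s(2) by (simp add: cauchy_in_def nZ)
    then obtain z where z: "converges_in B s z" using cauchy_converges[OF sB] by blast
    then have "converges_in B (\<lambda>n. P (s n)) (P z)"
      by (rule bounded_linear_map_converges[OF P(1) normed_space normed_space _ sB])
    moreover have "P (s n) = s n" for n by (rule fix_Z) (use s(1) in blast)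
    then have "(\<lambda>n. P (s n)) = s" by (rule ext)
    ultimately have "converges_in B s (P z)" by simp
    then have "P z = z" by (rule converges_in_unique[OF _ z sB])
    then have "z \<in> vecs Z" using converges_in_mem[OF z] by (intro mem_iff)
    then have "converges_in Z s z" using z by (simp add: converges_in_def nZ)
    then show ?thesis ..
  qed
  then have bZ: "banach_space Z" using nsZ by (simp add: banach_space_def)
  have PZ: "bounded_linear_map B Z P"
    using P(1) unfolding bounded_linear_map_def by (simp add: sZ nZ vZ)
  have "Z = B\<lparr>vecs := vecs Z\<rparr>" using P(3) vZ by simp
  from that[OF P(1) PZ fix_Z ZB this bZ] show thesis .
qed

text \<open>
  The basis vectors are mapped by the projection, the coefficient functionals are restricted;
  unconditional convergence is preserved by bounded linear maps.
\<close>

theorem frame_of_complemented: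
  fixes B :: "('k::{real_normed_field,euclidean_space}, 'b::ab_group_add) nspace"
    and X :: "('k, 'a::ab_group_add) nspace"
  assumes "banach_space B" and b: "unconditional_schauder_basis B b"
    and Z: "complemented_subspace B Z" and iso: "isomorphic X Z" and X: "normed_space X"
  shows "\<exists>F. unconditional_schauder_frame X F"
proof -
  interpret basis B b
    using banach_nspaceI[OF assms(1)] b
    by (simp add: basis_def basis_axioms_def unconditional_schauder_basis_def)
  obtain P where P: "bounded_linear_map B Z P" "\<And>z. z \<in> vecs Z \<Longrightarrow> P z = z"
    "vecs Z \<subseteq> vecs B" "Z = B\<lparr>vecs := vecs Z\<rparr>" "banach_space Z"
    by (rule complemented_subspaceE[OF Z assms(1)]) blast
  have nsZ: "normed_space Z" using P(5) by (simp add: banach_space_def)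
  obtain T U where T: "bounded_linear_map X Z T" and U: "bounded_linear_map Z X U"
    and UT: "\<And>x. x \<in> vecs X \<Longrightarrow> U (T x) = x"
    using iso unfolding isomorphic_def by blast
  have sZ: "scal Z = scal B" and nZ: "nrm Z = nrm B" by (subst P(4), simp)+
  have TB: "bounded_linear_map X B T"
    using T P(3) unfolding bounded_linear_map_def by (auto simp: sZ nZ)
  have UP: "bounded_linear_map B X (\<lambda>y. U (P y))"
    by (rule bounded_linear_map_comp[OF P(1) U normed_space nsZ])
  note UP' = bounded_linear_mapD[OF UP]
  let ?F = "\<lambda>n. (U (P (b n)), \<lambda>x. coeff (T x) n)"
  have "?F n \<in> vecs X \<times> topological_dual X" for n
  proof -
    have "bounded_linear_map B scalar_space (\<lambda>x. coeff x n)"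
      using coeff_dual by (simp add: topological_dual_def)
    from bounded_linear_map_comp[OF TB this X normed_space]
    show ?thesis using UP'(1)[OF basis_mem] by (simp add: topological_dual_def)
  qed
  moreover have "unconditionally_sums_in X (\<lambda>n. scal X (coeff (T x) n) (U (P (b n)))) x"
    if x: "x \<in> vecs X" for x
    unfolding unconditionally_sums_in_def
  proof (intro allI impI)
    fix \<pi> :: "nat \<Rightarrow> nat" assume \<pi>: "bij \<pi>"
    have Tx: "T x \<in> vecs Z" "T x \<in> vecs B"
      using bounded_linear_mapD(1)[OF T x] bounded_linear_mapD(1)[OF TB x] by auto
    let ?t = "\<lambda>n. scal B (coeff (T x) n) (b n)"
    have "unconditionally_sums_in B ?t (T x)"
      using b coeff_sums[OF Tx(2)] Tx(2) unfolding unconditional_schauder_basis_def by blast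
    then have "sums_in B (?t \<circ> \<pi>) (T x)" using \<pi> unfolding unconditionally_sums_in_def by blast
    moreover have "range (?t \<circ> \<pi>) \<subseteq> vecs B" using basis_mem by auto
    ultimately have "sums_in X (\<lambda>n. U (P ((?t \<circ> \<pi>) n))) (U (P (T x)))"
      by (rule bounded_linear_map_sums[OF UP normed_space X])
    moreover have "(\<lambda>n. U (P ((?t \<circ> \<pi>) n))) = (\<lambda>n. scal X (coeff (T x) n) (U (P (b n)))) \<circ> \<pi>"
      using UP'(3)[OF basis_mem] by auto
    ultimately show "sums_in X ((\<lambda>n. scal X (coeff (T x) n) (U (P (b n)))) \<circ> \<pi>) x"
      using P(2)[OF Tx(1)] UT[OF x] by simp
  qed
  ultimately have "unconditional_schauder_frame X ?F"
    unfolding unconditional_schauder_frame_def by auto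
  then show ?thesis by blast
qed

lemma isomorphic_refl: "isomorphic X X"
proof -
  have "bounded_linear_map X X (\<lambda>x. x)"
    unfolding bounded_linear_map_def by (simp, intro exI[of _ 1], simp)
  then show ?thesis unfolding isomorphic_def by blast
qed

lemma isomorphic_trans:
  assumes "isomorphic X Y" "isomorphic Y Z" "normed_space X" "normed_space Y" "normed_space Z"
  shows "isomorphic X Z"
proof -
  obtain T U where T: "bounded_linear_map X Y T" and U: "bounded_linear_map Y X U"
    and "\<forall>x\<in>vecs X. U (T x) = x" "\<forall>y\<in>vecs Y. T (U y) = y"
    using assms(1) unfolding isomorphic_def by blast
  moreover obtain S R where S: "bounded_linear_map Y Z S" and R: "bounded_linear_map Z Y R"
    and "\<forall>y\<in>vecs Y. R (S y) = y" "\<forall>z\<in>vecs Z. S (R z) = z"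
    using assms(2) unfolding isomorphic_def by blast
  ultimately have "\<forall>x\<in>vecs X. U (R (S (T x))) = x" "\<forall>z\<in>vecs Z. S (T (U (R z))) = z"
    using bounded_linear_mapD(1)[OF T] bounded_linear_mapD(1)[OF R] by auto
  then show ?thesis
    unfolding isomorphic_def
    using bounded_linear_map_comp[OF T S assms(3,4)] bounded_linear_map_comp[OF R U assms(5,4)]
    by (intro exI[of _ "\<lambda>x. S (T x)"] exI[of _ "\<lambda>z. U (R z)"]) simp
qed

section \<open>The universal space\<close>

lemma frame_complemented_in_universal:
  fixes X :: "('k::{real_normed_field,euclidean_space}, 'a::ab_group_add) nspace"
  assumes "banach_space X" and F: "unconditional_schauder_frame X F"
  shows "\<exists>Z. complemented_subspace (wspace universal_weights :: ('k, nat \<Rightarrow> 'k) nspace) Z \<and> isomorphic X Z"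
proof -
  have mem: "F n \<in> vecs X \<times> topological_dual X" for n
    using F unfolding unconditional_schauder_frame_def by blast
  interpret banach_nspace X by (rule banach_nspaceI) fact
  interpret frame X "\<lambda>n. fst (F n)" "\<lambda>n. snd (F n)"
  proof
    show "fst (F n) \<in> vecs X" "snd (F n) \<in> topological_dual X" for n
      using mem[of n] by (simp_all add: mem_Times_iff)
    show "unconditionally_sums_in X (\<lambda>n. scal X (snd (F n) x) (fst (F n))) x" if "x \<in> vecs X" for x
      using F that unfolding unconditional_schauder_frame_def by blast
  qed
  show ?thesis by (rule complemented_in_universal)
qed

lemma characterizes_framesI:
  fixes B :: "('k::{real_normed_field,euclidean_space}, 'b::ab_group_add) nspace"
  assumes B: "separable_with_unconditional_basis B"
    and "\<And>(X :: ('k, 'a::ab_group_add) nspace) F. banach_space X \<Longrightarrow> unconditional_schauder_frame X F \<Longrightarrow>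
      \<exists>Z. complemented_subspace B Z \<and> isomorphic X Z"
  shows "characterizes_frames TYPE('a) B"
  unfolding characterizes_frames_def
proof (intro allI impI iffI)
  fix X :: "('k, 'a) nspace"
  assume X: "banach_space X"
  show "\<exists>Z. complemented_subspace B Z \<and> isomorphic X Z" if "\<exists>F. unconditional_schauder_frame X F"
    using assms(2) X that by blast
  obtain b where "banach_space B" "unconditional_schauder_basis B b"
    using B unfolding separable_with_unconditional_basis_def by blast
  moreover have "normed_space X" using X by (simp add: banach_space_def)
  ultimately show "\<exists>F. unconditional_schauder_frame X F"
    if "\<exists>Z. complemented_subspace B Z \<and> isomorphic X Z"
    using that frame_of_complemented by blast
qed

theorem universal_space_exists:
  "\<exists>B :: ('k::{real_normed_field,euclidean_space}, nat \<Rightarrow> 'k) nspace.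
     separable_with_unconditional_basis B \<and> characterizes_frames TYPE('a::ab_group_add) B"
proof (intro exI conjI)
  show "separable_with_unconditional_basis (wspace universal_weights :: ('k, nat \<Rightarrow> 'k) nspace)"
    by (rule universal.separable_with_unconditional_basis_wspace)
  then show "characterizes_frames TYPE('a) (wspace universal_weights :: ('k, nat \<Rightarrow> 'k) nspace)"
    by (rule characterizes_framesI) (rule frame_complemented_in_universal)
qed

text \<open>
  The complemented copy \<open>Z\<close> of \<open>X\<close> in the universal space is a Banach space of sequences with a
  frame, so the hypothesis on \<open>B\<close> applies to it.
\<close>

theorem universality_transfers:
  fixes B :: "('k::{real_normed_field,euclidean_space}, nat \<Rightarrow> 'k) nspace"
  assumes B: "separable_with_unconditional_basis B"
    and char: "characterizes_frames TYPE(nat \<Rightarrow> 'k) B"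
  shows "characterizes_frames TYPE('a::ab_group_add) B"
proof (rule characterizes_framesI[OF B])
  let ?B0 = "wspace universal_weights :: ('k, nat \<Rightarrow> 'k) nspace"
  fix X :: "('k, 'a) nspace" and F
  assume X: "banach_space X" and F: "unconditional_schauder_frame X F"
  obtain Z where Z: "complemented_subspace ?B0 Z" "isomorphic X Z"
    using frame_complemented_in_universal[OF X F] by blast
  have banachZ: "banach_space Z"
    by (rule complemented_subspaceE[OF Z(1) universal.banach_space_wspace])
  then have nZ: "normed_space Z" by (simp add: banach_space_def)
  have "\<exists>G. unconditional_schauder_frame Z G"
    by (rule frame_of_complemented[OF universal.banach_space_wspace
          universal.unconditional_basis_wspace Z(1) isomorphic_refl nZ])
  then obtain Z' where Z': "complemented_subspace B Z'" "isomorphic Z Z'"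
    using char banachZ unfolding characterizes_frames_def by blast
  have "banach_space B" using B by (simp add: separable_with_unconditional_basis_def)
  have "banach_space Z'"
    by (rule complemented_subspaceE[OF Z'(1) \<open>banach_space B\<close>])
  then have "isomorphic X Z'"
    using isomorphic_trans[OF Z(2) Z'(2)] X nZ by (simp add: banach_space_def)
  then show "\<exists>Z. complemented_subspace B Z \<and> isomorphic X Z" using Z'(1) by blast
qed

theorem corollary7:
  shows
    "((\<exists>B :: (real, nat \<Rightarrow> real) nspace.
         separable_with_unconditional_basis B \<and> characterizes_frames TYPE(nat \<Rightarrow> real) B) \<and>
      (\<forall>B :: (real, nat \<Rightarrow> real) nspace.
         separable_with_unconditional_basis B \<and> characterizes_frames TYPE(nat \<Rightarrow> real) B \<longrightarrow>
         characterizes_frames TYPE('a::ab_group_add) B)) \<and>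
     ((\<exists>B :: (complex, nat \<Rightarrow> complex) nspace.
         separable_with_unconditional_basis B \<and> characterizes_frames TYPE(nat \<Rightarrow> complex) B) \<and>
      (\<forall>B :: (complex, nat \<Rightarrow> complex) nspace.
         separable_with_unconditional_basis B \<and> characterizes_frames TYPE(nat \<Rightarrow> complex) B \<longrightarrow>
         characterizes_frames TYPE('a::ab_group_add) B))"
  by (intro conjI allI impI universal_space_exists; elim conjE; rule universality_transfers)

end
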